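(* Let $T>0$ and $d\in\mathbb{N}$. If $X\in\mathcal{K}$, with Lévy measure $\nu$, then the random vector $Z^{(d)}=(Z_1,Z_2,\dots,Z_d)^{\mathbf{T}}$ of the first $d$ stochastic coefficients of the Karhunen–Loève expansion of $X$ on $[0,T]$ has independent entries if, and only if, $\nu$ is the zero measure.
   Context: A one-dimensional Lévy process $X$ satisfies $\mathbb{E}[e^{izX_t}]=e^{-t\Psi_X(z)}$ for $z\in\mathbb{R}$, $t\ge0$, with $\Psi_X(z)=\tfrac12\sigma^2z^2-iaz-\int_{\mathbb{R}\setminus\{0\}}\left(e^{izx}-1-izx\,h(x)\right)\nu(dx)$, where $a\in\mathbb{R}$, $\sigma^2\ge0$, $h$ is a cut-off function, and the Lévy measure $\nu$ is a measure on $\mathbb{R}\setminus\{0\}$ with $\int_{\mathbb{R}\setminus\{0\}}\min(1,x^2)\,\nu(dx)<\infty$. $\mathcal{K}$ is the set of one-dimensional Lévy processes with $\mathbb{E}[X_t]=0$ and $\mathbb{E}[X_t^2]<\infty$ for every $t\ge0$. For $X\in\mathcal{K}$ the stochastic coefficients of the Karhunen–Loève expansion on $[0,T]$ are $Z_k=\int_0^TX_t\,e_k(t)\,dt$, $k\in\mathbb{N}$, where $e_k(t)=\sqrt{\tfrac2T}\,\sin\!\left(\tfrac{\pi}{T}\left(k-\tfrac12\right)t\right)$, $t\in[0,T]$, are the normalized eigenfunctions of the integral operator on $L^2([0,T])$ with kernel $\mathrm{Cov}(X_s,X_t)$, ordered by decreasing eigenvalue.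
   Formalization: The equivalence is proved for d ≥ 2 and, for d = 1, only the "if" direction: for d = 1 a one-entry vector always has independent entries, so "only if" fails, e.g. for the compensated Poisson process, whose Lévy measure is nonzero. *)

theory Defs
  imports "HOL-Probability.Probability"
begin

definition cadlag :: "(real \<Rightarrow> real) \<Rightarrow> bool" where
  "cadlag f \<longleftrightarrow>
     (\<forall>t\<ge>0. continuous (at_right t) f) \<and>
     (\<forall>t>0. \<exists>l. (f \<longlongrightarrow> l) (at_left t))"

(* The time index set is [0, infinity); the values of X at negative times play no role.
   All paths, rather than almost all, are cadlag, so that pathwise integrals
   are random variables also when M is not complete. *)
locale levy_process = prob_space M for M :: "'a measure" +
  fixes X :: "real \<Rightarrow> 'a \<Rightarrow> real"
  assumes random_variable_X: "t \<ge> 0 \<Longrightarrow> random_variable borel (X t)"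
    and cadlag_paths: "\<omega> \<in> space M \<Longrightarrow> cadlag (\<lambda>t. X t \<omega>)"
    and start_zero: "AE \<omega> in M. X 0 \<omega> = 0"
    and indep_increments:
      "\<And>(n::nat) t. \<lbrakk>0 \<le> t 0; \<And>i. i < n \<Longrightarrow> t i < t (Suc i)\<rbrakk> \<Longrightarrow>
         indep_vars (\<lambda>_. borel) (\<lambda>i \<omega>. X (t (Suc i)) \<omega> - X (t i) \<omega>) {..<n}"
    and stationary_increments:
      "\<lbrakk>s \<ge> 0; t \<ge> 0\<rbrakk> \<Longrightarrow>
         distr M borel (\<lambda>\<omega>. X (s + t) \<omega> - X s \<omega>) = distr M borel (X t)"
    and stochastically_continuous:
      "\<lbrakk>t \<ge> 0; \<epsilon> > 0\<rbrakk> \<Longrightarrow>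
         ((\<lambda>s. prob {\<omega> \<in> space M. \<bar>X s \<omega> - X t \<omega>\<bar> \<ge> \<epsilon>}) \<longlongrightarrow> 0) (at t within {0..})"

locale centered_L2_levy_process = levy_process +
  assumes square_integrable: "t \<ge> 0 \<Longrightarrow> integrable M (\<lambda>\<omega>. (X t \<omega>)\<^sup>2)"
    and mean_zero: "t \<ge> 0 \<Longrightarrow> expectation (X t) = 0"

(* A measure on the punctured line is encoded as a Borel measure on the line with no mass at 0. *)
definition levy_measure :: "real measure \<Rightarrow> bool" where
  "levy_measure \<nu> \<longleftrightarrow>
     sets \<nu> = sets borel \<and> emeasure \<nu> {0} = 0 \<and>
     (\<integral>\<^sup>+ x. ennreal (min 1 (x\<^sup>2)) \<partial>\<nu>) < \<infinity>"

definition levy_khintchine_integrand :: "(real \<Rightarrow> real) \<Rightarrow> real \<Rightarrow> real \<Rightarrow> complex" where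
  "levy_khintchine_integrand h z x =
     exp (\<i> * of_real (z * x)) - 1 - \<i> * of_real (z * x * h x)"

(* Which functions are admissible depends on the measure: the indicator of [-1,1] is a cut-off
   function for every Levy measure, the constant 1 only for those with finite first moment away
   from 0.  The integrability condition covers both; without it the Bochner integral in the
   exponent would take the default value 0. *)
definition cutoff_function :: "real measure \<Rightarrow> (real \<Rightarrow> real) \<Rightarrow> bool" where
  "cutoff_function \<nu> h \<longleftrightarrow>
     h \<in> borel_measurable borel \<and>
     (\<forall>z. integrable \<nu> (levy_khintchine_integrand h z))"

definition levy_exponent ::
    "(real \<Rightarrow> real) \<Rightarrow> real \<Rightarrow> real \<Rightarrow> real measure \<Rightarrow> real \<Rightarrow> complex" where
  "levy_exponent h a \<sigma> \<nu> z =
     of_real (\<sigma>\<^sup>2 * z\<^sup>2 / 2) - \<i> * of_real (a * z)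
       - (CLINT x|\<nu>. levy_khintchine_integrand h z x)"

definition has_levy_triplet ::
    "'a measure \<Rightarrow> (real \<Rightarrow> 'a \<Rightarrow> real) \<Rightarrow> (real \<Rightarrow> real) \<Rightarrow> real \<Rightarrow> real \<Rightarrow> real measure \<Rightarrow> bool" where
  "has_levy_triplet M X h a \<sigma> \<nu> \<longleftrightarrow>
     levy_measure \<nu> \<and> cutoff_function \<nu> h \<and>
     (\<forall>t\<ge>0. \<forall>z. (CLINT \<omega>|M. exp (\<i> * of_real (z * X t \<omega>)))
                    = exp (- of_real t * levy_exponent h a \<sigma> \<nu> z))"

definition kl_eigenfunction :: "real \<Rightarrow> nat \<Rightarrow> real \<Rightarrow> real" where
  "kl_eigenfunction T k t = sqrt (2 / T) * sin (pi / T * (real k - 1/2) * t)"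

definition kl_coefficient :: "real \<Rightarrow> (real \<Rightarrow> 'a \<Rightarrow> real) \<Rightarrow> nat \<Rightarrow> 'a \<Rightarrow> real" where
  "kl_coefficient T X k \<omega> = (LINT t:{0..T}|lborel. X t \<omega> * kl_eigenfunction T k t)"

definition independent_kl_coefficients ::
    "'a measure \<Rightarrow> (real \<Rightarrow> 'a \<Rightarrow> real) \<Rightarrow> real \<Rightarrow> nat \<Rightarrow> bool" where
  "independent_kl_coefficients M X T d \<longleftrightarrow>
     prob_space.indep_vars M (\<lambda>_. borel) (kl_coefficient T X) {1..d}"

end

theory Submission
  imports Defs
begin

text \<open>
  Write \<open>\<psi>\<close> for the Levy exponent of \<open>X\<close> and \<open>E\<^sub>k(t)\<close> for the integral of the eigenfunction
  \<open>e\<^sub>k\<close> over \<open>[t, T]\<close>, a multiple of \<open>cos (\<pi> (k - 1/2) t / T)\<close>. A linear combination of the coefficients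
  is a path integral of \<open>X\<close> against a continuous weight \<open>g\<close>. Summation by parts in its Riemann sums
  turns it into a sum of independent increments weighted by the tail integrals \<open>G\<close> of \<open>g\<close>, and in the limit
  the characteristic function of the path integral is \<open>exp (- \<integral> \<psi>(G(t)) dt)\<close>
  (\<open>char_weighted_path_integral\<close>). Hence the joint characteristic function of
  \<open>(Z\<^sub>k)\<close> at \<open>u\<close> is \<open>exp (- \<integral> \<psi>(\<Sum>k. u\<^sub>k E\<^sub>k(t)) dt)\<close> (\<open>char_kl_coefficients\<close>).

  If \<open>\<nu>\<close> vanishes, \<open>\<psi>\<close> is a quadratic polynomial, and since the cosines \<open>E\<^sub>k\<close> are orthogonal on
  \<open>[0, T]\<close>, the exponent splits into a sum over \<open>k\<close>. A joint characteristic function that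
  factors means independence (\<open>indep_vars_if_char_factors\<close>).

  Conversely, let \<open>Z\<^sub>j\<close> and \<open>Z\<^sub>k\<close> be independent and \<open>\<rho> = Re \<psi>\<close>. Taking absolute values of
  the characteristic functions at \<open>(1, 1)\<close> and \<open>(1, -1)\<close> gives
  \<open>\<integral> 2 \<rho>(E\<^sub>j) + 2 \<rho>(E\<^sub>k) - \<rho>(E\<^sub>j + E\<^sub>k) - \<rho>(E\<^sub>j - E\<^sub>k) dt = 0\<close>.
  The parallelogram law removes the Gaussian part of this expression, and by the addition theorem for
  the cosine the integrand equals
  \<open>\<integral> 2 (1 - cos (E\<^sub>j(t) x)) (1 - cos (E\<^sub>k(t) x)) \<nu>(dx)\<close> (\<open>parallelogram_defect\<close>). It is nonnegative and
  continuous in \<open>t\<close>, so it vanishes for every \<open>t\<close>. As \<open>t\<close> increases to \<open>T\<close>, both \<open>E\<^sub>j(t)\<close> and \<open>E\<^sub>k(t)\<close>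
  tend to \<open>0\<close> through nonzero values, so for every \<open>x \<noteq> 0\<close> the \<open>\<nu>\<close>-integrand is positive for
  some \<open>t\<close>. Therefore \<open>\<nu>\<close> has no mass.
\<close>

section \<open>Independence from factoring characteristic functions\<close>

text \<open>
  Reweighting the probability by the positive density \<open>V + 2\<close>, suitably normalized, leaves the
  characteristic function of \<open>Z\<close> unchanged. By Levy's uniqueness theorem it leaves the distribution of
  \<open>Z\<close> unchanged as well, which is the claim.
\<close>

lemma (in prob_space) uncorrelated_with_characters_imp_uncorrelated_with_events_real:
  fixes V :: "'a \<Rightarrow> real"
  assumes [measurable]: "random_variable borel Z" "V \<in> borel_measurable M" "A \<in> sets borel"
    and bounded: "\<And>\<omega>. \<omega> \<in> space M \<Longrightarrow> \<bar>V \<omega>\<bar> \<le> 1"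
    and factor: "\<And>u. (CLINT \<omega>|M. of_real (V \<omega>) * iexp (u * Z \<omega>)) =
                       of_real (expectation V) * (CLINT \<omega>|M. iexp (u * Z \<omega>))"
  shows "expectation (\<lambda>\<omega>. V \<omega> * indicator A (Z \<omega>)) = expectation V * prob {\<omega> \<in> space M. Z \<omega> \<in> A}"
proof -
  define c where "c = expectation V + 2"
  have int_V: "integrable M V"
    using bounded by (intro integrable_const_bound[where B=1]) auto
  have "expectation V \<ge> expectation (\<lambda>_. -1)"
    using bounded int_V by (intro integral_mono) (auto simp: abs_le_iff minus_le_iff)
  then have c: "c > 0"
    by (simp add: c_def prob_space)
  define w where "w = (\<lambda>\<omega>. (V \<omega> + 2) / c)"
  have w_nonneg: "0 \<le> w \<omega>" if "\<omega> \<in> space M" for \<omega>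
    using bounded[OF that] c by (auto simp: w_def)
  have [measurable]: "w \<in> borel_measurable M"
    by (simp add: w_def)
  have int_w: "integrable M w"
    using int_V by (simp add: w_def)
  have E_w: "expectation w = 1"
    using int_V c by (simp add: w_def c_def prob_space)
  define N where "N = density M (\<lambda>\<omega>. ennreal (w \<omega>))"
  have N_space: "space N = space M" "sets N = sets M"
    by (simp_all add: N_def)
  have [measurable]: "Z \<in> borel_measurable N"
    by (simp add: N_def)
  have integral_N: "integral\<^sup>L N f = (LINT \<omega>|M. w \<omega> *\<^sub>R f \<omega>)"
    if "f \<in> borel_measurable M" for f :: "'a \<Rightarrow> 'b::{banach, second_countable_topology}"
    unfolding N_def using that w_nonneg by (intro integral_density) auto
  have "prob_space N"
  proof
    have "emeasure N (space N) = (\<integral>\<^sup>+ \<omega>. ennreal (w \<omega>) \<partial>M)"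
      by (simp add: N_def emeasure_density cong: nn_integral_cong)
    also have "\<dots> = ennreal (expectation w)"
      using int_w w_nonneg by (intro nn_integral_eq_integral) auto
    finally show "emeasure N (space N) = 1"
      by (simp add: E_w)
  qed
  then interpret N: prob_space N .
  have "char (distr N borel Z) u = char (distr M borel Z) u" for u
  proof -
    have int_Z: "integrable M (\<lambda>\<omega>. iexp (u * Z \<omega>))"
      by (rule integrable_iexp) (simp_all flip: of_real_mult)
    have int_VZ: "integrable M (\<lambda>\<omega>. of_real (V \<omega>) * iexp (u * Z \<omega>))"
      using bounded by (intro integrable_const_bound[where B=1]) (auto simp: norm_mult)
    have "char (distr N borel Z) u = (CLINT \<omega>|M. w \<omega> *\<^sub>R iexp (u * Z \<omega>))"
      by (simp add: char_def integral_distr integral_N)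
    also have "\<dots> = (CLINT \<omega>|M. (of_real (V \<omega>) * iexp (u * Z \<omega>) + 2 * iexp (u * Z \<omega>)) / of_real c)"
      using c by (intro Bochner_Integration.integral_cong)
        (auto simp: w_def scaleR_conv_of_real field_simps)
    also have "\<dots> = ((CLINT \<omega>|M. of_real (V \<omega>) * iexp (u * Z \<omega>)) + 2 * (CLINT \<omega>|M. iexp (u * Z \<omega>))) / of_real c"
      using int_Z int_VZ by simp
    also have "\<dots> = of_real (expectation V + 2) * (CLINT \<omega>|M. iexp (u * Z \<omega>)) / of_real c"
      by (simp only: factor) (simp add: algebra_simps)
    also have "\<dots> = (CLINT \<omega>|M. iexp (u * Z \<omega>))"
      using c unfolding c_def[symmetric] by simp
    finally show ?thesis
      by (simp add: char_def integral_distr)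
  qed
  then have "distr N borel Z = distr M borel Z"
    by (intro Levy_uniqueness N.real_distribution_distr real_distribution_distr) (auto simp: N_def)
  then have "measure (distr N borel Z) A = measure (distr M borel Z) A"
    by simp
  then have "measure N (Z -` A \<inter> space M) = prob {\<omega> \<in> space M. Z \<omega> \<in> A}"
    by (simp add: measure_distr N_space vimage_def Int_def conj_commute)
  moreover have "measure N (Z -` A \<inter> space M) = (LINT \<omega>|N. indicator A (Z \<omega>))"
  proof -
    have "(LINT \<omega>|N. indicator A (Z \<omega>) :: real) = (LINT \<omega>|N. indicator (Z -` A \<inter> space M) \<omega>)"
      by (intro Bochner_Integration.integral_cong) (auto simp: indicator_def N_space)
    then show ?thesis
      by (simp add: N_space)
  qed
  moreover have "\<dots> = (LINT \<omega>|M. (V \<omega> * indicator A (Z \<omega>) + 2 * indicator A (Z \<omega>)) / c)"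
    by (subst integral_N) (auto intro!: Bochner_Integration.integral_cong simp: w_def field_simps)
  moreover have "\<dots> = (expectation (\<lambda>\<omega>. V \<omega> * indicator A (Z \<omega>)) + 2 * prob {\<omega> \<in> space M. Z \<omega> \<in> A}) / c"
  proof -
    have "integrable M (\<lambda>\<omega>. V \<omega> * indicator A (Z \<omega>))"
      using bounded by (intro integrable_const_bound[where B=1]) (auto simp: indicator_def)
    moreover have "integrable M (\<lambda>\<omega>. indicator A (Z \<omega>) :: real)"
      by (intro integrable_const_bound[where B=1]) (auto simp: indicator_def)
    moreover have "expectation (\<lambda>\<omega>. indicator A (Z \<omega>)) = prob {\<omega> \<in> space M. Z \<omega> \<in> A}"
    proof -
      have "expectation (\<lambda>\<omega>. indicator A (Z \<omega>)) = expectation (indicator {\<omega> \<in> space M. Z \<omega> \<in> A})"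
        by (intro Bochner_Integration.integral_cong) (auto simp: indicator_def)
      also have "\<dots> = prob ({\<omega> \<in> space M. Z \<omega> \<in> A} \<inter> space M)"
        by (rule Bochner_Integration.integral_indicator)
      also have "{\<omega> \<in> space M. Z \<omega> \<in> A} \<inter> space M = {\<omega> \<in> space M. Z \<omega> \<in> A}"
        by auto
      finally show ?thesis .
    qed
    ultimately show ?thesis by simp
  qed
  ultimately show ?thesis
    using c by (simp add: c_def field_simps)
qed

text \<open>
  The hypothesis is stable under complex conjugation of \<open>W\<close>, because conjugation only replaces
  \<open>u\<close> by \<open>- u\<close>; so it passes to the real and imaginary parts of \<open>W\<close>.
\<close>

lemma (in prob_space) uncorrelated_with_characters_imp_uncorrelated_with_events:
  fixes W :: "'a \<Rightarrow> complex"
  assumes [measurable]: "random_variable borel Z" "W \<in> borel_measurable M" "A \<in> sets borel"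
    and bounded: "\<And>\<omega>. \<omega> \<in> space M \<Longrightarrow> norm (W \<omega>) \<le> 1"
    and factor: "\<And>u. (CLINT \<omega>|M. W \<omega> * iexp (u * Z \<omega>)) =
                       (CLINT \<omega>|M. W \<omega>) * (CLINT \<omega>|M. iexp (u * Z \<omega>))"
  shows "(CLINT \<omega>|M. W \<omega> * indicator A (Z \<omega>)) =
         (CLINT \<omega>|M. W \<omega>) * of_real (prob {\<omega> \<in> space M. Z \<omega> \<in> A})"
proof -
  have int_W: "integrable M W"
    using bounded by (intro integrable_const_bound[where B=1]) auto
  have int_WZ: "integrable M (\<lambda>\<omega>. W \<omega> * iexp (u * Z \<omega>))" for u
    using bounded by (intro integrable_const_bound[where B=1]) (auto simp: norm_mult)
  have [measurable]: "(\<lambda>\<omega>. cnj (W \<omega>)) \<in> borel_measurable M"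
    by (intro borel_measurable_continuous_on[of cnj] continuous_intros) simp
  have int_cWZ: "integrable M (\<lambda>\<omega>. cnj (W \<omega>) * iexp (u * Z \<omega>))" for u
    using bounded by (intro integrable_const_bound[where B=1]) (auto simp: norm_mult)
  have factor_cnj: "(CLINT \<omega>|M. cnj (W \<omega>) * iexp (u * Z \<omega>)) =
      cnj (CLINT \<omega>|M. W \<omega>) * (CLINT \<omega>|M. iexp (u * Z \<omega>))" for u
  proof -
    have cnj_iexp: "cnj (iexp (- u * Z \<omega>)) = iexp (u * Z \<omega>)" for \<omega>
      by (simp add: exp_cnj)
    have "(CLINT \<omega>|M. cnj (W \<omega>) * iexp (u * Z \<omega>)) = (CLINT \<omega>|M. cnj (W \<omega> * iexp (- u * Z \<omega>)))"
      unfolding complex_cnj_mult cnj_iexp ..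
    also have "\<dots> = cnj (CLINT \<omega>|M. W \<omega> * iexp (- u * Z \<omega>))"
      by (rule Bochner_Integration.integral_cnj)
    also have "\<dots> = cnj (CLINT \<omega>|M. W \<omega>) * cnj (CLINT \<omega>|M. iexp (- u * Z \<omega>))"
      by (simp only: factor complex_cnj_mult)
    also have "cnj (CLINT \<omega>|M. iexp (- u * Z \<omega>)) = (CLINT \<omega>|M. cnj (iexp (- u * Z \<omega>)))"
      by (rule Bochner_Integration.integral_cnj[symmetric])
    finally show ?thesis
      unfolding cnj_iexp .
  qed
  have Re: "expectation (\<lambda>\<omega>. Re (W \<omega>) * indicator A (Z \<omega>)) =
      expectation (\<lambda>\<omega>. Re (W \<omega>)) * prob {\<omega> \<in> space M. Z \<omega> \<in> A}"
  proof (rule uncorrelated_with_characters_imp_uncorrelated_with_events_real)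
    fix u
    have "(CLINT \<omega>|M. of_real (Re (W \<omega>)) * iexp (u * Z \<omega>)) =
        (CLINT \<omega>|M. (W \<omega> * iexp (u * Z \<omega>) + cnj (W \<omega>) * iexp (u * Z \<omega>)) / 2)"
      unfolding distrib_right[symmetric] complex_add_cnj by simp
    also have "\<dots> = ((CLINT \<omega>|M. W \<omega>) + cnj (CLINT \<omega>|M. W \<omega>)) / 2 * (CLINT \<omega>|M. iexp (u * Z \<omega>))"
      using int_WZ[of u] int_cWZ[of u] factor_cnj[of u] factor[of u] by (simp add: algebra_simps)
    finally show "(CLINT \<omega>|M. of_real (Re (W \<omega>)) * iexp (u * Z \<omega>)) =
        of_real (expectation (\<lambda>\<omega>. Re (W \<omega>))) * (CLINT \<omega>|M. iexp (u * Z \<omega>))"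
      unfolding complex_add_cnj using int_W by simp
  next
    show "\<And>\<omega>. \<omega> \<in> space M \<Longrightarrow> \<bar>Re (W \<omega>)\<bar> \<le> 1"
      using abs_Re_le_cmod bounded order_trans by blast
  qed measurable
  have Im_eq: "(w - cnj w) / (2 * \<i>) = of_real (Im w)" for w
    by (simp add: complex_eq_iff Re_divide Im_divide power2_eq_square)
  have Im: "expectation (\<lambda>\<omega>. Im (W \<omega>) * indicator A (Z \<omega>)) =
      expectation (\<lambda>\<omega>. Im (W \<omega>)) * prob {\<omega> \<in> space M. Z \<omega> \<in> A}"
  proof (rule uncorrelated_with_characters_imp_uncorrelated_with_events_real)
    fix u
    have "(CLINT \<omega>|M. of_real (Im (W \<omega>)) * iexp (u * Z \<omega>)) =
        (CLINT \<omega>|M. (W \<omega> * iexp (u * Z \<omega>) - cnj (W \<omega>) * iexp (u * Z \<omega>)) / (2 * \<i>))"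
      by (intro Bochner_Integration.integral_cong refl)
        (simp add: complex_diff_cnj field_simps flip: left_diff_distrib)
    also have "\<dots> = ((CLINT \<omega>|M. W \<omega>) - cnj (CLINT \<omega>|M. W \<omega>)) / (2 * \<i>) * (CLINT \<omega>|M. iexp (u * Z \<omega>))"
      using int_WZ[of u] int_cWZ[of u] factor_cnj[of u] factor[of u] by (simp add: algebra_simps)
    finally show "(CLINT \<omega>|M. of_real (Im (W \<omega>)) * iexp (u * Z \<omega>)) =
        of_real (expectation (\<lambda>\<omega>. Im (W \<omega>))) * (CLINT \<omega>|M. iexp (u * Z \<omega>))"
      unfolding Im_eq using int_W by simp
  next
    show "\<And>\<omega>. \<omega> \<in> space M \<Longrightarrow> \<bar>Im (W \<omega>)\<bar> \<le> 1"
      using abs_Im_le_cmod bounded order_trans by blast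
  qed measurable
  have int_WA: "integrable M (\<lambda>\<omega>. W \<omega> * indicator A (Z \<omega>))"
    using bounded by (intro integrable_const_bound[where B=1]) (auto simp: norm_mult indicator_def)
  have Re_ind: "Re (indicator A z) = indicator A z" and Im_ind: "Im (indicator A z) = 0" for z :: real
    by (auto simp: indicator_def)
  show ?thesis
    using Re Im int_W int_WA
    by (simp add: complex_eq_iff Re_ind Im_ind flip: integral_Re integral_Im)
qed

text \<open>
  A multivariate form of the uniqueness theorem that needs only the one-dimensional one: in the
  product formula for the exponentials, the factors \<open>exp (\<i> u\<^sub>k Z\<^sub>k)\<close> are exchanged one
  coordinate at a time for indicators of events \<open>Z\<^sub>k \<in> A\<^sub>k\<close>. At each exchange, the
  product of the remaining factors is the weight \<open>W\<close> of the preceding lemma.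
\<close>

lemma (in prob_space) indep_vars_if_char_factors:
  fixes Z :: "'i \<Rightarrow> 'a \<Rightarrow> real"
  assumes "finite I" and rv: "\<And>k. k \<in> I \<Longrightarrow> random_variable borel (Z k)"
    and factor: "\<And>u. (CLINT \<omega>|M. iexp (\<Sum>k\<in>I. u k * Z k \<omega>)) =
                       (\<Prod>k\<in>I. CLINT \<omega>|M. iexp (u k * Z k \<omega>))"
  shows "indep_vars (\<lambda>_. borel) Z I"
proof -
  have product: "(CLINT \<omega>|M. \<Prod>k\<in>I. if k \<in> J then indicator (A k) (Z k \<omega>) else iexp (u k * Z k \<omega>)) =
      (\<Prod>k\<in>I. if k \<in> J then of_real (prob {\<omega> \<in> space M. Z k \<omega> \<in> A k}) else CLINT \<omega>|M. iexp (u k * Z k \<omega>))"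
    if "finite J" "J \<subseteq> I" "\<And>k. k \<in> J \<Longrightarrow> A k \<in> sets borel" for J A u
    using that
  proof (induction J arbitrary: u rule: finite_induct)
    case empty
    have "(CLINT \<omega>|M. \<Prod>k\<in>I. iexp (u k * Z k \<omega>)) = (CLINT \<omega>|M. iexp (\<Sum>k\<in>I. u k * Z k \<omega>))"
      by (simp add: exp_sum \<open>finite I\<close> sum_distrib_left)
    then show ?case
      by (simp only: factor empty_iff if_False)
  next
    case (insert j J)
    define F where "F = (\<lambda>u k \<omega>. if k \<in> J then indicator (A k) (Z k \<omega>) else iexp (u k * Z k \<omega>) :: complex)"
    define f where "f = (\<lambda>u k. if k \<in> J then of_real (prob {\<omega> \<in> space M. Z k \<omega> \<in> A k})
        else CLINT \<omega>|M. iexp (u k * Z k \<omega>))"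
    have IH: "(CLINT \<omega>|M. \<Prod>k\<in>I. F u k \<omega>) = (\<Prod>k\<in>I. f u k)" for u
      unfolding F_def f_def using insert by (intro insert.IH) auto
    have j: "j \<in> I" "j \<notin> J" and [measurable]: "A j \<in> sets borel"
      using insert by auto
    have [measurable]: "Z k \<in> borel_measurable M" if "k \<in> I" for k
      using rv that by simp
    have A_meas: "A k \<in> sets borel" if "k \<in> J" for k
      using insert that by auto
    have F_meas: "F u k \<in> borel_measurable M" if "k \<in> I" for k u
      using that A_meas[of k] by (cases "k \<in> J") (auto simp: F_def)
    define W where "W = (\<lambda>\<omega>. \<Prod>k\<in>I-{j}. F u k \<omega>)"
    have split: "(\<Prod>k\<in>I. F (u(j := v)) k \<omega>) = W \<omega> * iexp (v * Z j \<omega>)" for v \<omega>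
      unfolding W_def using \<open>finite I\<close> j
      by (subst prod.remove[of _ j]) (auto simp: F_def mult.commute intro!: arg_cong2[where f="(*)"] prod.cong split: if_splits)
    have split_f: "(\<Prod>k\<in>I. f (u(j := v)) k) = (\<Prod>k\<in>I-{j}. f u k) * (CLINT \<omega>|M. iexp (v * Z j \<omega>))" for v
      using \<open>finite I\<close> j
      by (subst prod.remove[of _ j]) (auto simp: f_def mult.commute intro!: arg_cong2[where f="(*)"] prod.cong split: if_splits)
    have WZ: "(CLINT \<omega>|M. W \<omega> * iexp (v * Z j \<omega>)) =
        (\<Prod>k\<in>I-{j}. f u k) * (CLINT \<omega>|M. iexp (v * Z j \<omega>))" for v
      using IH[of "u(j := v)"] unfolding split split_f .
    \<comment> \<open>Taking \<open>v = 0\<close> identifies the constant factor as the mean of \<open>W\<close>.\<close>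
    have EW: "(CLINT \<omega>|M. W \<omega>) = (\<Prod>k\<in>I-{j}. f u k)"
      using WZ[of 0] by (simp add: prob_space)
    have "(CLINT \<omega>|M. W \<omega> * indicator (A j) (Z j \<omega>)) =
        (CLINT \<omega>|M. W \<omega>) * of_real (prob {\<omega> \<in> space M. Z j \<omega> \<in> A j})"
    proof (rule uncorrelated_with_characters_imp_uncorrelated_with_events)
      show "W \<in> borel_measurable M"
        unfolding W_def using F_meas by (intro borel_measurable_prod) auto
      show "norm (W \<omega>) \<le> 1" for \<omega>
        unfolding W_def prod_norm[symmetric]
        by (intro prod_le_1) (auto simp: F_def indicator_def)
    qed (use j WZ EW in auto)
    moreover have "(\<Prod>k\<in>I. if k \<in> insert j J then indicator (A k) (Z k \<omega>) else iexp (u k * Z k \<omega>)) =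
        W \<omega> * indicator (A j) (Z j \<omega>)" for \<omega>
      unfolding W_def using \<open>finite I\<close> j
      by (subst prod.remove[of _ j]) (auto simp: F_def mult.commute intro!: arg_cong2[where f="(*)"] prod.cong split: if_splits)
    moreover have "(\<Prod>k\<in>I. if k \<in> insert j J then of_real (prob {\<omega> \<in> space M. Z k \<omega> \<in> A k})
          else CLINT \<omega>|M. iexp (u k * Z k \<omega>)) =
        (\<Prod>k\<in>I-{j}. f u k) * of_real (prob {\<omega> \<in> space M. Z j \<omega> \<in> A j})"
      using \<open>finite I\<close> j
      by (subst prod.remove[of _ j]) (auto simp: f_def mult.commute intro!: arg_cong2[where f="(*)"] prod.cong split: if_splits)
    ultimately show ?case
      unfolding EW by simp
  qed
  show ?thesis
    unfolding indep_vars_def2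
  proof (intro conjI ballI rv indep_setsI)
    fix A J assume J: "J \<noteq> {}" "J \<subseteq> I" "finite J"
      and A: "\<forall>j\<in>J. A j \<in> {Z j -` B \<inter> space M |B. B \<in> sets borel}"
    from A have "\<forall>j\<in>J. \<exists>B. B \<in> sets borel \<and> A j = Z j -` B \<inter> space M"
      by auto
    then obtain B where B: "\<And>j. j \<in> J \<Longrightarrow> B j \<in> sets borel" "\<And>j. j \<in> J \<Longrightarrow> A j = {\<omega> \<in> space M. Z j \<omega> \<in> B j}"
      unfolding bchoice_iff by (auto simp: vimage_def Int_def conj_commute)
    have A_events: "A j \<in> events" if "j \<in> J" for j
      using B[OF that] rv[of j] J that by auto
    then have "(\<Inter>j\<in>J. A j) \<in> events"
      using J by auto
    moreover have "of_real (indicator (\<Inter>j\<in>J. A j) \<omega>) =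
        (\<Prod>k\<in>I. if k \<in> J then indicator (B k) (Z k \<omega>) else iexp (0 * Z k \<omega>))" if "\<omega> \<in> space M" for \<omega>
    proof -
      have "(\<Prod>k\<in>I. if k \<in> J then indicator (B k) (Z k \<omega>) else iexp (0 * Z k \<omega>)) =
          (\<Prod>k\<in>J. indicator (B k) (Z k \<omega>) :: complex)"
        using J \<open>finite I\<close> by (simp add: prod.If_cases Int_absorb1)
      also have "\<dots> = of_real (indicator (\<Inter>j\<in>J. A j) \<omega>)"
        using J B that by (auto simp: indicator_def prod_eq_1_iff)
      finally show ?thesis ..
    qed
    \<comment> \<open>Frequency \<open>0\<close> outside \<open>J\<close> turns the other factors into \<open>1\<close>.\<close>
    ultimately have "(CLINT \<omega>|M. \<Prod>k\<in>I. if k \<in> J then indicator (B k) (Z k \<omega>) else iexp (0 * Z k \<omega>)) =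
        (CLINT \<omega>|M. of_real (indicator (\<Inter>j\<in>J. A j) \<omega>))"
      by (intro Bochner_Integration.integral_cong) auto
    also have "\<dots> = of_real (expectation (indicator (\<Inter>j\<in>J. A j)))"
      by (rule integral_complex_of_real)
    also have "expectation (indicator (\<Inter>j\<in>J. A j)) = prob (\<Inter>j\<in>J. A j)"
      using \<open>(\<Inter>j\<in>J. A j) \<in> events\<close> by (simp add: sets.Int_space_eq2)
    finally have "of_real (prob (\<Inter>j\<in>J. A j)) =
        (CLINT \<omega>|M. \<Prod>k\<in>I. if k \<in> J then indicator (B k) (Z k \<omega>) else iexp (0 * Z k \<omega>))" ..
    also have "\<dots> = (\<Prod>k\<in>I. if k \<in> J then of_real (prob {\<omega> \<in> space M. Z k \<omega> \<in> B k}) else CLINT \<omega>|M. iexp (0 * Z k \<omega>))"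
      using J B by (intro product) auto
    also have "\<dots> = of_real (\<Prod>j\<in>J. prob (A j))"
      using J \<open>finite I\<close> B by (simp add: prod.If_cases Int_absorb1 prob_space)
    finally show "prob (\<Inter>j\<in>J. A j) = (\<Prod>j\<in>J. prob (A j))"
      by (simp only: of_real_eq_iff)
  qed (use rv in auto)
qed

section \<open>Riemann sums of cadlag functions\<close>

text \<open>
  The value at the right end of each half-open cell is used because then the evaluation points
  approach every \<open>t\<close> from the right, the side on which cadlag functions are continuous.
\<close>

definition right_step :: "real \<Rightarrow> nat \<Rightarrow> (real \<Rightarrow> 'b::real_vector) \<Rightarrow> real \<Rightarrow> 'b" where
  "right_step T n f t =
     (\<Sum>j<n. indicator {T * real j / real n<..T * real (Suc j) / real n} t *\<^sub>R f (T * real (Suc j) / real n))"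

lemma right_step_eq_nearby_value:
  assumes "T > 0" "n > 0" "0 < t" "t \<le> T"
  obtains s where "t \<le> s" "s < t + T / real n" "s \<le> T" "right_step T n f t = f s"
proof -
  define m where "m = nat \<lceil>real n * t / T\<rceil>"
  have pos: "0 < real n * t / T" and le: "real n * t / T \<le> real n"
    using assms by (auto simp: field_simps)
  have m: "0 < m" "m \<le> n" "real m - 1 < real n * t / T" "real n * t / T \<le> real m"
    using pos le unfolding m_def by linarith+
  define j where "j = m - 1"
  have j: "m = Suc j" "j < n"
    using m by (auto simp: j_def)
  have t_in: "indicator {T * real i / real n<..T * real (Suc i) / real n} t = (if i = j then 1 else 0 :: real)" for i
  proof -
    have "t \<in> {T * real i / real n<..T * real (Suc i) / real n} \<longleftrightarrow>
        real i < real n * t / T \<and> real n * t / T \<le> real i + 1"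
      using assms by (auto simp: field_simps)
    also have "\<dots> \<longleftrightarrow> i = j"
      using m j by auto
    finally show ?thesis by (simp add: indicator_def)
  qed
  have "right_step T n f t = f (T * real m / real n)"
    unfolding right_step_def t_in using j by (simp add: if_distrib[of "\<lambda>c. c *\<^sub>R _"] sum.delta cong: if_cong)
  moreover have "t \<le> T * real m / real n" "T * real m / real n < t + T / real n" "T * real m / real n \<le> T"
    using m assms by (auto simp: field_simps)
  ultimately show ?thesis
    using that by blast
qed

lemma right_step_tendsto:
  fixes f :: "real \<Rightarrow> 'b::real_normed_vector"
  assumes "T > 0" "0 < t" "t \<le> T" and cont: "continuous (at_right t) f"
  shows "(\<lambda>n. right_step T n f t) \<longlonglongrightarrow> f t"
proof (rule LIMSEQ_I)
  fix e :: real assume "e > 0"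
  with cont have "eventually (\<lambda>s. dist (f s) (f t) < e) (at_right t)"
    unfolding continuous_within by (rule tendstoD)
  then obtain b where b: "b > t" "\<And>s. t < s \<Longrightarrow> s < b \<Longrightarrow> dist (f s) (f t) < e"
    unfolding eventually_at_right_field by auto
  obtain N :: nat where N: "T / (b - t) < real N"
    using reals_Archimedean2 by blast
  show "\<exists>N. \<forall>n\<ge>N. norm (right_step T n f t - f t) < e"
  proof (intro exI allI impI)
    fix n assume "n \<ge> N"
    with N have "T / (b - t) < real n" by linarith
    moreover have "0 < T / (b - t)"
      using \<open>T > 0\<close> b by simp
    ultimately have "0 < real n" by linarith
    with \<open>T / (b - t) < real n\<close> have n: "n > 0" "t + T / real n < b"
      using b(1) by (simp_all add: field_simps)
    obtain s where "t \<le> s" "s < t + T / real n" "right_step T n f t = f s"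
      using right_step_eq_nearby_value[of T n t] assms n by metis
    then show "norm (right_step T n f t - f t) < e"
      using b n \<open>e > 0\<close> by (cases "s = t") (auto simp: dist_norm)
  qed
qed

lemma right_step_outside:
  assumes "T > 0" "t \<notin> {0<..T}"
  shows "right_step T n f t = 0"
proof -
  have "t \<notin> {T * real j / real n<..T * real (Suc j) / real n}" if "j < n" for j
  proof -
    have "0 \<le> T * real j / real n" "T * real (Suc j) / real n \<le> T"
      using \<open>T > 0\<close> that mult_left_mono[of "real (Suc j)" "real n" T]
      by (auto simp: pos_divide_le_eq simp del: of_nat_Suc)
    then show ?thesis
      using assms(2) unfolding greaterThanAtMost_iff by linarith
  qed
  then show ?thesis
    unfolding right_step_def by (intro sum.neutral) auto
qed

text \<open>
  The sums are integrals of the step functions, which converge pointwise by right-continuity and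
  are uniformly bounded, so dominated convergence applies. The limit inherits its measurability from them.
\<close>

lemma right_sums_tendsto_set_integral:
  fixes f :: "real \<Rightarrow> 'b::euclidean_space" and g :: "real \<Rightarrow> real"
  assumes "T > 0" and g: "continuous_on UNIV g"
    and G: "\<And>t. (G has_real_derivative g t) (at t)"
    and bounded: "bounded (f ` {0..T})"
    and cont: "\<And>t. 0 \<le> t \<Longrightarrow> t \<le> T \<Longrightarrow> continuous (at_right t) f"
  shows "set_integrable lborel {0..T} (\<lambda>t. g t *\<^sub>R f t)"
    and "(\<lambda>n. \<Sum>j<n. (G (T * real (Suc j) / real n) - G (T * real j / real n)) *\<^sub>R f (T * real (Suc j) / real n))
           \<longlonglongrightarrow> (LINT t:{0..T}|lborel. g t *\<^sub>R f t)"
proof -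
  obtain B where B: "\<And>t. 0 \<le> t \<Longrightarrow> t \<le> T \<Longrightarrow> norm (f t) \<le> B"
    using bounded unfolding bounded_iff by fastforce
  then have "B \<ge> 0"
    using \<open>T > 0\<close> norm_ge_zero[of "f 0"] B[of 0] by linarith
  have [measurable]: "g \<in> borel_measurable borel"
    using g by (rule borel_measurable_continuous_onI)
  have [measurable]: "right_step T n f \<in> borel_measurable borel" for n
    unfolding right_step_def[abs_def] by measurable
  define s where "s = (\<lambda>n t. g t *\<^sub>R right_step T n f t)"
  define F where "F = (\<lambda>t. indicator {0<..T} t *\<^sub>R (g t *\<^sub>R f t))"
  have lim: "(\<lambda>n. s n t) \<longlonglongrightarrow> F t" for t
  proof (cases "t \<in> {0<..T}")
    case True
    then have "(\<lambda>n. s n t) \<longlonglongrightarrow> g t *\<^sub>R f t"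
      unfolding s_def using assms by (intro tendsto_intros right_step_tendsto) auto
    then show ?thesis using True by (simp add: F_def)
  next
    case False
    then show ?thesis by (simp add: F_def s_def right_step_outside \<open>T > 0\<close>)
  qed
  have dom: "norm (s n t) \<le> indicator {0..T} t *\<^sub>R (\<bar>g t\<bar> * B)" for n t
  proof (cases "n > 0 \<and> t \<in> {0<..T}")
    case True
    then obtain r where "t \<le> r" "r \<le> T" "right_step T n f t = f r"
      using right_step_eq_nearby_value[of T n t] \<open>T > 0\<close> by (metis greaterThanAtMost_iff)
    then show ?thesis
      using True B[of r] by (auto simp: s_def intro!: mult_left_mono)
  next
    case False
    then have "right_step T n f t = 0"
      using right_step_outside[OF \<open>T > 0\<close>, of t n f] by (cases "n > 0") (auto simp: right_step_def)
    then show ?thesis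
      using \<open>B \<ge> 0\<close> by (simp add: s_def)
  qed
  have w: "integrable lborel (\<lambda>t. indicator {0..T} t *\<^sub>R (\<bar>g t\<bar> * B))"
  proof -
    have "continuous_on {0..T} (\<lambda>t. \<bar>g t\<bar> * B)"
      by (intro continuous_intros continuous_on_subset[OF g]) auto
    then have "set_integrable lborel {0..T} (\<lambda>t. \<bar>g t\<bar> * B)"
      by (rule borel_integrable_atLeastAtMost')
    then show ?thesis
      unfolding set_integrable_def .
  qed
  have [measurable]: "F \<in> borel_measurable borel"
    by (rule borel_measurable_LIMSEQ_metric[OF _ lim]) (simp add: s_def)
  have [measurable]: "s n \<in> borel_measurable borel" for n
    by (simp add: s_def)
  have F_lim: "(\<lambda>n. integral\<^sup>L lborel (s n)) \<longlonglongrightarrow> integral\<^sup>L lborel F"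
    by (rule integral_dominated_convergence[OF _ _ w]) (use lim dom in \<open>simp_all del: real_scaleR_def\<close>)
  have F_int: "integrable lborel F"
    by (rule integrable_dominated_convergence[where s = s, OF _ _ w]) (use lim dom in \<open>simp_all del: real_scaleR_def\<close>)
  have AE_eq: "AE t in lborel. F t = indicator {0..T} t *\<^sub>R (g t *\<^sub>R f t)"
    using AE_lborel_singleton[of 0] by eventually_elim (auto simp: F_def indicator_def)
  have meas': "(\<lambda>t. indicator {0..T} t *\<^sub>R (g t *\<^sub>R f t)) \<in> borel_measurable borel"
  proof -
    have "(\<lambda>t. indicator {0..T} t *\<^sub>R (g t *\<^sub>R f t)) = (\<lambda>t. F t + indicator {0} t *\<^sub>R (g 0 *\<^sub>R f 0))"
      using \<open>T > 0\<close> by (auto simp: F_def indicator_def fun_eq_iff)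
    then show ?thesis by simp
  qed
  show "set_integrable lborel {0..T} (\<lambda>t. g t *\<^sub>R f t)"
    unfolding set_integrable_def using F_int AE_eq meas'
    by (subst (asm) integrable_cong_AE[OF _ _ AE_eq]) auto
  have "integral\<^sup>L lborel F = (LINT t:{0..T}|lborel. g t *\<^sub>R f t)"
    unfolding set_lebesgue_integral_def using AE_eq meas' by (intro integral_cong_AE) auto
  moreover have "integral\<^sup>L lborel (s n) =
      (\<Sum>j<n. (G (T * real (Suc j) / real n) - G (T * real j / real n)) *\<^sub>R f (T * real (Suc j) / real n))" for n
  proof -
    have cell: "has_bochner_integral lborel (\<lambda>t. (g t * indicator {a<..b} t) *\<^sub>R y) ((G b - G a) *\<^sub>R y)"
      if "a \<le> b" for a b and y :: 'b
    proof -
      have "has_bochner_integral lborel (\<lambda>t. g t * indicator {a..b} t) (G b - G a)"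
        using that G g by (intro has_bochner_integral_FTC_Icc_real)
          (auto simp: continuous_on_eq_continuous_at)
      moreover have "AE t in lborel. g t * indicator {a..b} t = g t * indicator {a<..b} t"
        using AE_lborel_singleton[of a] by eventually_elim (auto simp: indicator_def)
      ultimately have "has_bochner_integral lborel (\<lambda>t. g t * indicator {a<..b} t) (G b - G a)"
        by (subst (asm) has_bochner_integral_cong_AE) auto
      then show ?thesis
        by (intro has_bochner_integral_scaleR_left)
    qed
    have "has_bochner_integral lborel
        (\<lambda>t. \<Sum>j<n. (g t * indicator {T * real j / real n<..T * real (Suc j) / real n} t) *\<^sub>R f (T * real (Suc j) / real n))
        (\<Sum>j<n. (G (T * real (Suc j) / real n) - G (T * real j / real n)) *\<^sub>R f (T * real (Suc j) / real n))"
      using \<open>T > 0\<close> by (intro has_bochner_integral_sum cell) (auto simp: divide_right_mono)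
    then show ?thesis
      unfolding s_def right_step_def scaleR_sum_right scaleR_scaleR by (rule has_bochner_integral_integral_eq)
  qed
  ultimately show "(\<lambda>n. \<Sum>j<n. (G (T * real (Suc j) / real n) - G (T * real j / real n)) *\<^sub>R f (T * real (Suc j) / real n))
           \<longlonglongrightarrow> (LINT t:{0..T}|lborel. g t *\<^sub>R f t)"
    using F_lim by simp
qed

text \<open>
  One-sided limits bound the function near each point, and finitely many such neighbourhoods cover
  the interval.
\<close>

lemma cadlag_bounded:
  assumes "cadlag f"
  shows "bounded (f ` {0..T})"
proof -
  have local: "\<exists>U. open U \<and> t \<in> U \<and> bounded (f ` (U \<inter> {0..T}))" if "t \<in> {0..T}" for t
  proof -
    from that have "t \<ge> 0" by simp
    have "(f \<longlongrightarrow> f t) (at_right t)"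
      using assms \<open>t \<ge> 0\<close> by (auto simp: cadlag_def continuous_within)
    then have "eventually (\<lambda>s. dist (f s) (f t) < 1) (at_right t)"
      by (rule tendstoD) simp
    then obtain b where b: "b > t" "\<And>s. t < s \<Longrightarrow> s < b \<Longrightarrow> dist (f s) (f t) < 1"
      unfolding eventually_at_right_field by auto
    obtain a l where a: "a < t" "\<And>s. 0 \<le> s \<Longrightarrow> a < s \<Longrightarrow> s < t \<Longrightarrow> dist (f s) l < 1"
    proof (cases "t = 0")
      case True
      then show ?thesis by (intro that[of "-1" 0]) auto
    next
      case False
      then obtain l where "(f \<longlongrightarrow> l) (at_left t)"
        using assms \<open>t \<ge> 0\<close> by (force simp: cadlag_def)
      then have "eventually (\<lambda>s. dist (f s) l < 1) (at_left t)"
        by (rule tendstoD) simp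
      then show ?thesis
        unfolding eventually_at_left_field using that by blast
    qed
    have "f ` ({a<..<b} \<inter> {0..T}) \<subseteq> ball l 1 \<union> ball (f t) 1 \<union> {f t}"
    proof
      fix y assume "y \<in> f ` ({a<..<b} \<inter> {0..T})"
      then obtain s where s: "y = f s" "a < s" "s < b" "0 \<le> s" by auto
      then show "y \<in> ball l 1 \<union> ball (f t) 1 \<union> {f t}"
        using a(2)[of s] b(2)[of s] by (cases s t rule: linorder_cases) (auto simp: dist_commute)
    qed
    then have "bounded (f ` ({a<..<b} \<inter> {0..T}))"
      by (rule bounded_subset[rotated]) simp
    then show ?thesis
      using a(1) b(1) by (intro exI[of _ "{a<..<b}"]) auto
  qed
  then obtain U where U: "\<And>t. t \<in> {0..T} \<Longrightarrow> open (U t) \<and> t \<in> U t \<and> bounded (f ` (U t \<inter> {0..T}))"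
    by metis
  obtain D where D: "D \<subseteq> {0..T}" "finite D" "{0..T} \<subseteq> (\<Union>t\<in>D. U t)"
    by (rule compactE_image[of "{0..T}" "{0..T}" U]) (use U in auto)
  have "bounded (\<Union>t\<in>D. f ` (U t \<inter> {0..T}))"
    using D U by (intro bounded_UN) auto
  moreover have "f ` {0..T} \<subseteq> (\<Union>t\<in>D. f ` (U t \<inter> {0..T}))"
  proof
    fix y assume "y \<in> f ` {0..T}"
    then obtain s where s: "y = f s" "s \<in> {0..T}" by blast
    with D(3) obtain t where "t \<in> D" "s \<in> U t" by blast
    with s show "y \<in> (\<Union>t\<in>D. f ` (U t \<inter> {0..T}))" by blast
  qed
  ultimately show ?thesis
    by (rule bounded_subset)
qed

section \<open>The Levy exponent\<close>

lemma levy_measure_integrable_min: "levy_measure \<nu> \<Longrightarrow> integrable \<nu> (\<lambda>x. min 1 (x\<^sup>2))"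
  unfolding levy_measure_def
  by (intro integrableI_nonneg) (auto simp: measurable_cong_sets[of \<nu> borel borel borel])

text \<open>
  The standard truncation at \<open>1\<close> gives a majorant that is locally uniform in \<open>z\<close>: the
  second-order Taylor bound inside \<open>[-1, 1]\<close> and the trivial bound outside.
\<close>

lemma norm_iexp_compensated_le:
  "norm (iexp (z * x) - 1 - \<i> * of_real (z * (if \<bar>x\<bar> \<le> 1 then x else 0))) \<le> (z\<^sup>2 / 2 + 2) * min 1 (x\<^sup>2)"
proof (cases "\<bar>x\<bar> \<le> 1")
  case True
  have "norm (iexp (z * x) - 1 - \<i> * of_real (z * x)) \<le> \<bar>z * x\<bar>\<^sup>2 / 2"
    using iexp_approx1[of "z * x" 1] by (simp add: power2_eq_square algebra_simps)
  also have "\<dots> = z\<^sup>2 / 2 * x\<^sup>2"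
    by (simp add: power_mult_distrib)
  also have "\<dots> \<le> (z\<^sup>2 / 2 + 2) * x\<^sup>2"
    by (intro mult_right_mono) auto
  also have "x\<^sup>2 = min 1 (x\<^sup>2)"
    using True by (simp add: abs_square_le_1)
  finally show ?thesis
    using True by simp
next
  case False
  then have "min 1 (x\<^sup>2) = 1"
    using abs_square_le_1[of x] by simp
  moreover have "norm (iexp (z * x) - 1) \<le> norm (iexp (z * x)) + norm (1::complex)"
    by (rule norm_triangle_ineq4)
  ultimately show ?thesis
    using False by (simp del: of_real_mult) (smt (verit) zero_le_power2 field_sum_of_halves)
qed

text \<open>
  For an arbitrary cut-off function \<open>h\<close> no majorant of the integrand is at hand. Changing \<open>h\<close> to
  the indicator of \<open>[-1, 1]\<close> changes the integrand by \<open>\<i> z c(x)\<close>, where \<open>c\<close> is integrable because the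
  integrands at \<open>z = 1\<close> are, and dominated convergence applies to the rest.
\<close>

lemma continuous_levy_exponent:
  assumes levy: "levy_measure \<nu>" and cutoff: "cutoff_function \<nu> h"
  shows "continuous_on UNIV (levy_exponent h a \<sigma> \<nu>)"
proof -
  have [measurable_cong]: "sets \<nu> = sets borel"
    using levy by (simp add: levy_measure_def)
  define k where "k = (\<lambda>z x. iexp (z * x) - 1 - \<i> * of_real (z * (if \<bar>x\<bar> \<le> 1 then x else 0)))"
  define c where "c = (\<lambda>x. complex_of_real ((if \<bar>x\<bar> \<le> 1 then x else 0) - x * h x))"
  have int_min: "integrable \<nu> (\<lambda>x. min 1 (x\<^sup>2))"
    using levy by (rule levy_measure_integrable_min)
  have [measurable]: "k z \<in> borel_measurable \<nu>" for z
    unfolding k_def by measurable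
  have int_k: "integrable \<nu> (k z)" for z
  proof (rule Bochner_Integration.integrable_bound)
    show "integrable \<nu> (\<lambda>x. (z\<^sup>2 / 2 + 2) * min 1 (x\<^sup>2))"
      using int_min by (rule integrable_mult_right)
    have "norm (k z x) \<le> (z\<^sup>2 / 2 + 2) * min 1 (x\<^sup>2)" for x
      unfolding k_def by (rule norm_iexp_compensated_le)
    also have "(z\<^sup>2 / 2 + 2) * min 1 (x\<^sup>2) \<le> norm ((z\<^sup>2 / 2 + 2) * min 1 (x\<^sup>2))" for x
      unfolding real_norm_def by (rule abs_ge_self)
    finally show "AE x in \<nu>. norm (k z x) \<le> norm ((z\<^sup>2 / 2 + 2) * min 1 (x\<^sup>2))"
      by (rule AE_I2)
  qed measurable
  have split: "levy_khintchine_integrand h z x = k z x + \<i> * of_real z * c x" for z x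
    by (simp add: levy_khintchine_integrand_def k_def c_def algebra_simps)
  have int_c: "integrable \<nu> c"
  proof -
    have "integrable \<nu> (\<lambda>x. - \<i> * (levy_khintchine_integrand h 1 x - k 1 x))"
      using cutoff int_k by (intro integrable_mult_right Bochner_Integration.integrable_diff) (auto simp: cutoff_function_def)
    then show ?thesis
      by (simp add: split)
  qed
  have "levy_exponent h a \<sigma> \<nu> z = of_real (\<sigma>\<^sup>2 * z\<^sup>2 / 2) - \<i> * of_real (a * z)
      - ((CLINT x|\<nu>. k z x) + \<i> * of_real z * (CLINT x|\<nu>. c x))" for z
    unfolding levy_exponent_def split using int_k int_c by simp
  moreover have "continuous_on UNIV (\<lambda>z. CLINT x|\<nu>. k z x)"
  proof (intro continuous_at_imp_continuous_on ballI continuous_at_sequentiallyI)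
    fix z :: real and u :: "nat \<Rightarrow> real"
    assume u: "u \<longlonglongrightarrow> z"
    then obtain R where R: "\<And>n. \<bar>u n\<bar> \<le> R"
      using convergent_imp_Bseq[of u] by (auto simp: convergent_def Bseq_def)
    show "(\<lambda>n. CLINT x|\<nu>. k (u n) x) \<longlonglongrightarrow> (CLINT x|\<nu>. k z x)"
    proof (rule integral_dominated_convergence)
      show "integrable \<nu> (\<lambda>x. (R\<^sup>2 / 2 + 2) * min 1 (x\<^sup>2))"
        using int_min by (rule integrable_mult_right)
      show "AE x in \<nu>. (\<lambda>n. k (u n) x) \<longlonglongrightarrow> k z x"
        unfolding k_def using u by (intro AE_I2 tendsto_intros)
      show "AE x in \<nu>. norm (k (u n) x) \<le> (R\<^sup>2 / 2 + 2) * min 1 (x\<^sup>2)" for n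
      proof (rule AE_I2)
        fix x
        have "(u n)\<^sup>2 \<le> R\<^sup>2"
          using R[of n] abs_le_square_iff[of "u n" R] by simp
        then have "((u n)\<^sup>2 / 2 + 2) * min 1 (x\<^sup>2) \<le> (R\<^sup>2 / 2 + 2) * min 1 (x\<^sup>2)"
          by (intro mult_right_mono) auto
        then show "norm (k (u n) x) \<le> (R\<^sup>2 / 2 + 2) * min 1 (x\<^sup>2)"
          unfolding k_def using norm_iexp_compensated_le[of "u n" x] by linarith
      qed
    qed measurable
  qed
  ultimately show ?thesis
    by (auto intro!: continuous_intros)
qed

lemma Re_levy_exponent:
  assumes "cutoff_function \<nu> h"
  shows "integrable \<nu> (\<lambda>x. 1 - cos (z * x))"
    and "Re (levy_exponent h a \<sigma> \<nu> z) = \<sigma>\<^sup>2 * z\<^sup>2 / 2 + (LINT x|\<nu>. 1 - cos (z * x))"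
proof -
  have int: "integrable \<nu> (levy_khintchine_integrand h z)"
    using assms by (simp add: cutoff_function_def)
  have Re: "Re (levy_khintchine_integrand h z x) = - (1 - cos (z * x))" for x
    by (simp add: levy_khintchine_integrand_def Re_exp)
  have int': "integrable \<nu> (\<lambda>x. - (1 - cos (z * x)))"
    using integrable_Re[OF int] unfolding Re .
  then show "integrable \<nu> (\<lambda>x. 1 - cos (z * x))"
    using integrable_minus[OF int'] by simp
  have "Re (CLINT x|\<nu>. levy_khintchine_integrand h z x) = (LINT x|\<nu>. - (1 - cos (z * x)))"
    unfolding integral_Re[OF int, symmetric] Re ..
  also have "\<dots> = - (LINT x|\<nu>. 1 - cos (z * x))"
    by (rule integral_minus)
  finally show "Re (levy_exponent h a \<sigma> \<nu> z) = \<sigma>\<^sup>2 * z\<^sup>2 / 2 + (LINT x|\<nu>. 1 - cos (z * x))"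
    by (simp add: levy_exponent_def)
qed

text \<open>
  The quadratic part of the exponent satisfies the parallelogram law, so only the jumps
  contribute to this defect; for them the identity is
  \<open>cos (y + z) + cos (y - z) = 2 cos y cos z\<close>. The integrand on the right is nonnegative.
\<close>

lemma parallelogram_defect:
  fixes a \<sigma> :: real
  assumes "cutoff_function \<nu> h"
  defines "\<rho> \<equiv> \<lambda>z. Re (levy_exponent h a \<sigma> \<nu> z)"
  shows "integrable \<nu> (\<lambda>x. 2 * (1 - cos (z * x)) * (1 - cos (w * x)))"
    and "2 * \<rho> z + 2 * \<rho> w - \<rho> (z + w) - \<rho> (z - w) =
         (LINT x|\<nu>. 2 * (1 - cos (z * x)) * (1 - cos (w * x)))"
proof -
  note int = Re_levy_exponent(1)[OF assms(1)]
  have eq: "2 * (1 - cos (z * x)) * (1 - cos (w * x)) =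
      2 * (1 - cos (z * x)) + 2 * (1 - cos (w * x)) - (1 - cos ((z + w) * x)) - (1 - cos ((z - w) * x))" for x
    by (simp add: distrib_right left_diff_distrib cos_add cos_diff) (simp add: algebra_simps)
  show "integrable \<nu> (\<lambda>x. 2 * (1 - cos (z * x)) * (1 - cos (w * x)))"
    unfolding eq by (intro Bochner_Integration.integrable_add Bochner_Integration.integrable_diff integrable_mult_right int)
  have "(LINT x|\<nu>. 2 * (1 - cos (z * x)) * (1 - cos (w * x))) =
      2 * (LINT x|\<nu>. 1 - cos (z * x)) + 2 * (LINT x|\<nu>. 1 - cos (w * x))
      - (LINT x|\<nu>. 1 - cos ((z + w) * x)) - (LINT x|\<nu>. 1 - cos ((z - w) * x))"
    unfolding eq
    by (intro has_bochner_integral_integral_eq has_bochner_integral_add has_bochner_integral_diff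
        has_bochner_integral_mult_right has_bochner_integral_integrable int)
  moreover have "\<sigma>\<^sup>2 * (z + w)\<^sup>2 / 2 + \<sigma>\<^sup>2 * (z - w)\<^sup>2 / 2 = \<sigma>\<^sup>2 * z\<^sup>2 + \<sigma>\<^sup>2 * w\<^sup>2"
    by (simp add: power2_sum power2_diff field_simps)
  \<comment> \<open>The linear bookkeeping is stated for variables in place of the integrals and squares.\<close>
  moreover have "2 * (A / 2 + a') + 2 * (B / 2 + b') - (C / 2 + c') - (D / 2 + d') = i"
    if "i = 2 * a' + 2 * b' - c' - d'" "C / 2 + D / 2 = A + B" for A B C D a' b' c' d' i :: real
    using that by argo
  ultimately show "2 * \<rho> z + 2 * \<rho> w - \<rho> (z + w) - \<rho> (z - w) =
      (LINT x|\<nu>. 2 * (1 - cos (z * x)) * (1 - cos (w * x)))"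
    unfolding \<rho>_def Re_levy_exponent(2)[OF assms(1)] by blast
qed

section \<open>Characteristic functions of weighted path integrals\<close>

lemma abel_summation_increments:
  fixes c x :: "nat \<Rightarrow> real"
  shows "(\<Sum>j<n. (c j - c (Suc j)) * x (Suc j)) = c 0 * x 0 - c n * x n + (\<Sum>j<n. c j * (x (Suc j) - x j))"
  by (induction n) (auto simp: algebra_simps)

text \<open>
  For a weight \<open>g\<close> with primitive \<open>- G\<close>, the path integral against \<open>g\<close> is a limit of sums in
  which the cell between consecutive grid points has weight equal to the drop of \<open>G\<close>. This makes it a
  random variable and gives access to its characteristic function.
\<close>

context levy_process
begin

lemma weighted_path_integral:
  assumes "T > 0" "continuous_on UNIV g" "\<And>t. (G has_real_derivative - g t) (at t)" "\<omega> \<in> space M"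
  shows "set_integrable lborel {0..T} (\<lambda>t. g t * X t \<omega>)"
    and "(\<lambda>n. \<Sum>j<n. (G (T * real j / real n) - G (T * real (Suc j) / real n)) * X (T * real (Suc j) / real n) \<omega>)
           \<longlonglongrightarrow> (LINT t:{0..T}|lborel. g t * X t \<omega>)"
proof -
  have path: "cadlag (\<lambda>t. X t \<omega>)"
    using assms by (intro cadlag_paths)
  have primitive: "((\<lambda>t. - G t) has_real_derivative g t) (at t)" for t
    using DERIV_minus[OF assms(3)[of t]] by simp
  have right_continuous: "continuous (at_right t) (\<lambda>t. X t \<omega>)" if "0 \<le> t" "t \<le> T" for t
    using path that by (simp add: cadlag_def)
  note right_sums = right_sums_tendsto_set_integral[where f = "\<lambda>t. X t \<omega>",
    OF assms(1,2) primitive cadlag_bounded[OF path] right_continuous]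
  show "set_integrable lborel {0..T} (\<lambda>t. g t * X t \<omega>)"
    using right_sums(1) by simp
  show "(\<lambda>n. \<Sum>j<n. (G (T * real j / real n) - G (T * real (Suc j) / real n)) * X (T * real (Suc j) / real n) \<omega>)
           \<longlonglongrightarrow> (LINT t:{0..T}|lborel. g t * X t \<omega>)"
    using right_sums(2) by simp
qed

lemma random_variable_weighted_path_integral:
  assumes "T > 0" "continuous_on UNIV g" "\<And>t. (G has_real_derivative - g t) (at t)"
  shows "random_variable borel (\<lambda>\<omega>. LINT t:{0..T}|lborel. g t * X t \<omega>)"
proof -
  define S where "S = (\<lambda>n \<omega>. \<Sum>j<n. (G (T * real j / real n) - G (T * real (Suc j) / real n)) * X (T * real (Suc j) / real n) \<omega>)"
  define Y where "Y = (\<lambda>\<omega>. LINT t:{0..T}|lborel. g t * X t \<omega>)"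
  have "S n \<in> borel_measurable M" for n
    unfolding S_def using \<open>T > 0\<close> by (intro borel_measurable_sum borel_measurable_times random_variable_X) auto
  moreover have "(\<lambda>n. S n \<omega>) \<longlonglongrightarrow> Y \<omega>" if "\<omega> \<in> space M" for \<omega>
    unfolding S_def Y_def using assms that by (rule weighted_path_integral)
  ultimately have "Y \<in> borel_measurable M"
    by (rule borel_measurable_LIMSEQ_metric)
  then show ?thesis
    unfolding Y_def .
qed

text \<open>
  Since \<open>X\<close> starts at \<open>0\<close> and \<open>G\<close> ends at \<open>0\<close>, summation by parts leaves only independent
  stationary increments, each multiplied by the value of \<open>G\<close> at the left end of its cell.
\<close>

lemma char_riemann_sum:
  assumes triplet: "has_levy_triplet M X h a \<sigma> \<nu>" and "T > 0" "G T = 0" "n > 0"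
  shows "(CLINT \<omega>|M. iexp (\<Sum>j<n. (G (T * real j / real n) - G (T * real (Suc j) / real n)) * X (T * real (Suc j) / real n) \<omega>)) =
         exp (- (\<Sum>j<n. of_real (T / real n) * levy_exponent h a \<sigma> \<nu> (G (T * real j / real n))))"
proof -
  define p where "p = (\<lambda>j. T * real j / real n)"
  define D where "D = (\<lambda>j \<omega>. X (p (Suc j)) \<omega> - X (p j) \<omega>)"
  have p: "p 0 = 0" "p n = T" "p j \<ge> 0" "p (Suc j) = p j + T / real n" "p j < p (Suc j)" for j
    using \<open>T > 0\<close> \<open>n > 0\<close> by (auto simp: p_def field_simps)
  have [measurable]: "X (p j) \<in> borel_measurable M" for j
    using p by (intro random_variable_X)
  have indep: "indep_vars (\<lambda>_. borel) D {..<n}"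
    unfolding D_def using p by (intro indep_increments) auto
  have indep_exp: "indep_vars (\<lambda>_. borel) (\<lambda>j \<omega>. iexp (G (p j) * D j \<omega>)) {..<n}"
    by (rule indep_vars_compose2[OF indep]) measurable
  have one: "(CLINT \<omega>|M. iexp (G (p j) * D j \<omega>)) = exp (- (of_real (T / real n) * levy_exponent h a \<sigma> \<nu> (G (p j))))" for j
  proof -
    have Tn: "T / real n \<ge> 0" using \<open>T > 0\<close> by simp
    have [measurable]: "X (T / real n) \<in> borel_measurable M"
      using Tn by (intro random_variable_X)
    have "(CLINT \<omega>|M. iexp (G (p j) * D j \<omega>)) = char (distr M borel (D j)) (G (p j))"
      unfolding char_def by (subst integral_distr) (auto simp: D_def)
    also have "distr M borel (D j) = distr M borel (X (T / real n))"
      unfolding D_def p(4) using p Tn by (intro stationary_increments)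
    also have "char \<dots> (G (p j)) = (CLINT \<omega>|M. exp (\<i> * of_real (G (p j) * X (T / real n) \<omega>)))"
      unfolding char_def by (subst integral_distr) auto
    finally show ?thesis
      using triplet Tn by (simp add: has_levy_triplet_def)
  qed
  have "AE \<omega> in M. (\<Sum>j<n. (G (p j) - G (p (Suc j))) * X (p (Suc j)) \<omega>) = (\<Sum>j<n. G (p j) * D j \<omega>)"
    using start_zero
  proof eventually_elim
    case (elim \<omega>)
    then show ?case
      using abel_summation_increments[of "\<lambda>j. G (p j)" "\<lambda>j. X (p j) \<omega>" n] p \<open>G T = 0\<close> by (simp add: D_def)
  qed
  then have "(CLINT \<omega>|M. iexp (\<Sum>j<n. (G (p j) - G (p (Suc j))) * X (p (Suc j)) \<omega>)) =
      (CLINT \<omega>|M. iexp (\<Sum>j<n. G (p j) * D j \<omega>))"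
    by (intro integral_cong_AE) (auto simp: D_def simp del: of_real_sum)
  also have "\<dots> = (CLINT \<omega>|M. \<Prod>j<n. iexp (G (p j) * D j \<omega>))"
    by (simp add: sum_distrib_left exp_sum)
  also have "\<dots> = (\<Prod>j<n. CLINT \<omega>|M. iexp (G (p j) * D j \<omega>))"
    using indep_exp by (intro indep_vars_lebesgue_integral) (auto intro!: integrable_const_bound[where B=1] simp: D_def)
  also have "\<dots> = exp (- (\<Sum>j<n. of_real (T / real n) * levy_exponent h a \<sigma> \<nu> (G (p j))))"
    unfolding one by (simp add: exp_sum flip: sum_negf)
  finally show ?thesis
    unfolding p_def .
qed

text \<open>
  The characteristic functions of the Riemann sums are exponentials of Riemann sums of \<open>\<psi> \<circ> G\<close>.
\<close>

lemma char_weighted_path_integral: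
  assumes triplet: "has_levy_triplet M X h a \<sigma> \<nu>" and "T > 0"
    and g: "continuous_on UNIV g" and G: "\<And>t. (G has_real_derivative - g t) (at t)" and "G T = 0"
  shows "(CLINT \<omega>|M. iexp (LINT t:{0..T}|lborel. g t * X t \<omega>)) =
         exp (- (CLINT t:{0..T}|lborel. levy_exponent h a \<sigma> \<nu> (G t)))"
proof -
  define \<psi> where "\<psi> = levy_exponent h a \<sigma> \<nu>"
  define Y where "Y = (\<lambda>\<omega>. LINT t:{0..T}|lborel. g t * X t \<omega>)"
  define S where "S = (\<lambda>n \<omega>. \<Sum>j<n. (G (T * real j / real n) - G (T * real (Suc j) / real n)) * X (T * real (Suc j) / real n) \<omega>)"
  have "continuous_on UNIV \<psi>"
    unfolding \<psi>_def using triplet by (intro continuous_levy_exponent) (auto simp: has_levy_triplet_def)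
  moreover have "continuous_on UNIV G"
    using G by (intro DERIV_continuous_on) (auto intro: has_field_derivative_at_within)
  ultimately have cont: "continuous_on UNIV (\<lambda>t. \<psi> (G t))"
    by (rule continuous_on_compose2) auto
  have [measurable]: "Y \<in> borel_measurable M"
    unfolding Y_def using \<open>T > 0\<close> g G by (rule random_variable_weighted_path_integral)
  have [measurable]: "S n \<in> borel_measurable M" for n
    unfolding S_def using \<open>T > 0\<close>
    by (intro borel_measurable_sum borel_measurable_times random_variable_X) auto
  have "(\<lambda>n. CLINT \<omega>|M. iexp (S n \<omega>)) \<longlonglongrightarrow> (CLINT \<omega>|M. iexp (Y \<omega>))"
  proof (rule integral_dominated_convergence[where w="\<lambda>_. 1"])
    have "(\<lambda>n. S n \<omega>) \<longlonglongrightarrow> Y \<omega>" if "\<omega> \<in> space M" for \<omega>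
      unfolding S_def Y_def using \<open>T > 0\<close> g G that by (rule weighted_path_integral)
    then show "AE \<omega> in M. (\<lambda>n. iexp (S n \<omega>)) \<longlonglongrightarrow> iexp (Y \<omega>)"
      by (intro AE_I2 tendsto_intros)
  qed auto
  moreover have "(\<lambda>n. CLINT \<omega>|M. iexp (S n \<omega>)) \<longlonglongrightarrow> exp (- (CLINT t:{0..T}|lborel. \<psi> (G t)))"
  proof -
    have "(\<lambda>n. \<Sum>j<n. (T * real (Suc j) / real n - T * real j / real n) *\<^sub>R \<psi> (G (T * real (Suc j) / real n)))
        \<longlonglongrightarrow> (CLINT t:{0..T}|lborel. 1 *\<^sub>R \<psi> (G t))"
    proof (rule right_sums_tendsto_set_integral)
      show "bounded ((\<lambda>t. \<psi> (G t)) ` {0..T})"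
        using cont by (intro compact_imp_bounded compact_continuous_image) (auto elim: continuous_on_subset)
      show "continuous (at_right t) (\<lambda>t. \<psi> (G t))" for t
        using cont by (auto simp: continuous_on_eq_continuous_at intro: continuous_within_subset)
    qed (use \<open>T > 0\<close> in \<open>auto intro!: derivative_eq_intros\<close>)
    \<comment> \<open>The exponents sample \<open>\<psi> \<circ> G\<close> at left ends; passing to right ends costs one vanishing boundary term.\<close>
    moreover have "(\<lambda>n. of_real (T / real n) * (\<psi> (G 0) - \<psi> (G T))) \<longlonglongrightarrow> 0"
    proof -
      have "(\<lambda>n. of_real (T / real n) * (\<psi> (G 0) - \<psi> (G T))) \<longlonglongrightarrow> of_real 0 * (\<psi> (G 0) - \<psi> (G T))"
        by (intro tendsto_intros lim_const_over_n)
      then show ?thesis by simp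
    qed
    ultimately have "(\<lambda>n. exp (- ((\<Sum>j<n. (T * real (Suc j) / real n - T * real j / real n) *\<^sub>R \<psi> (G (T * real (Suc j) / real n)))
          + of_real (T / real n) * (\<psi> (G 0) - \<psi> (G T)))))
        \<longlonglongrightarrow> exp (- ((CLINT t:{0..T}|lborel. 1 *\<^sub>R \<psi> (G t)) + 0))"
      by (intro tendsto_intros)
    moreover have "eventually (\<lambda>n. exp (- ((\<Sum>j<n. (T * real (Suc j) / real n - T * real j / real n) *\<^sub>R \<psi> (G (T * real (Suc j) / real n)))
          + of_real (T / real n) * (\<psi> (G 0) - \<psi> (G T)))) = (CLINT \<omega>|M. iexp (S n \<omega>))) sequentially"
    proof (rule eventually_sequentiallyI[of 1])
      fix n :: nat assume "n \<ge> 1"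
      define q where "q = (\<lambda>j. \<psi> (G (T * real j / real n)))"
      have q: "q 0 = \<psi> (G 0)" "q n = \<psi> (G T)"
        using \<open>n \<ge> 1\<close> by (auto simp: q_def)
      have S: "(CLINT \<omega>|M. iexp (S n \<omega>)) = exp (- (\<Sum>j<n. of_real (T / real n) * q j))"
        unfolding S_def q_def \<psi>_def using triplet \<open>T > 0\<close> \<open>G T = 0\<close> \<open>n \<ge> 1\<close>
        by (intro char_riemann_sum) auto
      have "(\<Sum>j<n. (T * real (Suc j) / real n - T * real j / real n) *\<^sub>R q (Suc j)) = (\<Sum>j<n. of_real (T / real n) * q (Suc j))"
        by (intro sum.cong refl) (simp add: scaleR_conv_of_real field_simps)
      also have "\<dots> = (\<Sum>j<n. of_real (T / real n) * q j) - of_real (T / real n) * (q 0 - q n)"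
        by (simp only: sum_distrib_left[symmetric] right_diff_distrib[symmetric] sum_lessThan_telescope'[symmetric] sum_subtractf) simp
      finally have sums: "(\<Sum>j<n. (T * real (Suc j) / real n - T * real j / real n) *\<^sub>R \<psi> (G (T * real (Suc j) / real n))) =
          (\<Sum>j<n. of_real (T / real n) * q j) - of_real (T / real n) * (\<psi> (G 0) - \<psi> (G T))"
        unfolding q unfolding q_def .
      show "exp (- ((\<Sum>j<n. (T * real (Suc j) / real n - T * real j / real n) *\<^sub>R \<psi> (G (T * real (Suc j) / real n)))
          + of_real (T / real n) * (\<psi> (G 0) - \<psi> (G T)))) = (CLINT \<omega>|M. iexp (S n \<omega>))"
        unfolding S sums by simp
    qed
    ultimately show ?thesis
      by (auto elim: Lim_transform_eventually)
  qed
  ultimately show ?thesis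
    unfolding \<psi>_def Y_def by (rule LIMSEQ_unique)
qed

end

section \<open>Karhunen-Loeve coefficients\<close>

lemma set_integral_linear_combination:
  fixes f :: "'i \<Rightarrow> 'a \<Rightarrow> real"
  assumes "\<And>k. k \<in> I \<Longrightarrow> set_integrable M A (f k)"
  shows "(LINT t:A|M. (\<Sum>k\<in>I. u k * f k t)) = (\<Sum>k\<in>I. u k * (LINT t:A|M. f k t))"
proof -
  have "(LINT t:A|M. (\<Sum>k\<in>I. u k * f k t)) = (LINT t|M. (\<Sum>k\<in>I. u k * (indicator A t *\<^sub>R f k t)))"
    unfolding set_lebesgue_integral_def
    by (intro Bochner_Integration.integral_cong) (auto simp: sum_distrib_left mult_ac)
  also have "\<dots> = (\<Sum>k\<in>I. LINT t|M. u k * (indicator A t *\<^sub>R f k t))"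
    using assms unfolding set_integrable_def
    by (intro Bochner_Integration.integral_sum integrable_mult_right)
  finally show ?thesis
    unfolding set_lebesgue_integral_def integral_mult_right_zero .
qed

definition kl_frequency :: "real \<Rightarrow> nat \<Rightarrow> real" where
  "kl_frequency T k = pi / T * (real k - 1/2)"

text \<open>
  The integral of \<open>kl_eigenfunction T k\<close> over \<open>[t, T]\<close>, the factor that summation by parts
  attaches to the increment of the path at time \<open>t\<close>.
\<close>

definition kl_tail_integral :: "real \<Rightarrow> nat \<Rightarrow> real \<Rightarrow> real" where
  "kl_tail_integral T k t = sqrt (2 / T) / kl_frequency T k * cos (kl_frequency T k * t)"

lemma kl_frequency_nonzero: "T > 0 \<Longrightarrow> kl_frequency T k \<noteq> 0"
proof -
  assume "T > 0"
  moreover have "real k \<noteq> 1/2"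
  proof
    assume "real k = 1/2"
    then have "real (2 * k) = real 1" by simp
    then have "2 * k = 1" by (simp only: of_nat_eq_iff)
    then show False by presburger
  qed
  ultimately show "kl_frequency T k \<noteq> 0"
    by (simp add: kl_frequency_def)
qed

lemma cos_kl_frequency_endpoint: "T > 0 \<Longrightarrow> cos (kl_frequency T k * T) = 0"
proof -
  assume "T > 0"
  then have "kl_frequency T k * T = pi * real k - pi / 2"
    by (simp add: kl_frequency_def field_simps)
  then show ?thesis
    by (simp add: cos_diff)
qed

lemma kl_tail_integral_endpoint: "T > 0 \<Longrightarrow> kl_tail_integral T k T = 0"
  by (simp add: kl_tail_integral_def cos_kl_frequency_endpoint)

lemma has_derivative_kl_tail_integral:
  "T > 0 \<Longrightarrow> (kl_tail_integral T k has_real_derivative - kl_eigenfunction T k t) (at t)"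
  unfolding kl_tail_integral_def[abs_def] kl_eigenfunction_def kl_frequency_def[symmetric]
  using kl_frequency_nonzero[of T k] by (auto intro!: derivative_eq_intros)

lemma continuous_kl_eigenfunction: "continuous_on S (kl_eigenfunction T k)"
  unfolding kl_eigenfunction_def[abs_def] by (intro continuous_intros)

lemma continuous_kl_tail_integral: "continuous_on S (kl_tail_integral T k)"
  unfolding kl_tail_integral_def[abs_def] by (intro continuous_intros)

text \<open>
  The frequencies are half-integer multiples of \<open>\<pi> / T\<close>, so near the endpoint the cosine is, up
  to sign, the sine of the frequency times the distance \<open>s\<close> to \<open>T\<close>.
\<close>

lemma kl_tail_integral_near_endpoint:
  assumes "T > 0" "0 < \<bar>kl_frequency T k * s\<bar>" "\<bar>kl_frequency T k * s\<bar> < pi"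
  shows "kl_tail_integral T k (T - s) \<noteq> 0"
proof -
  define \<kappa> where "\<kappa> = kl_frequency T k"
  have "cos (\<kappa> * T) = 0"
    unfolding \<kappa>_def using \<open>T > 0\<close> by (rule cos_kl_frequency_endpoint)
  moreover from this have "sin (\<kappa> * T) \<noteq> 0"
    using sin_cos_squared_add[of "\<kappa> * T"] by auto
  moreover have "sin (\<kappa> * s) \<noteq> 0"
    using assms sin_zero_pi_iff[of "\<kappa> * s"] by (auto simp: \<kappa>_def)
  ultimately have "cos (\<kappa> * (T - s)) \<noteq> 0"
    by (simp add: right_diff_distrib cos_diff)
  then show ?thesis
    using assms kl_frequency_nonzero[of T k] by (simp add: kl_tail_integral_def \<kappa>_def)
qed

text \<open>
  Sums and differences of two frequencies are integer multiples of \<open>\<pi> / T\<close>, nonzero because both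
  indices are positive and distinct. (At index \<open>0\<close> the frequency is the negative of the one at \<open>1\<close>.)
\<close>

lemma kl_tail_integrals_orthogonal:
  assumes "T > 0" "j \<ge> 1" "k \<ge> 1" "j \<noteq> k"
  shows "(LINT t:{0..T}|lborel. kl_tail_integral T j t * kl_tail_integral T k t) = 0"
proof -
  define \<alpha> \<beta> where "\<alpha> = kl_frequency T j" and "\<beta> = kl_frequency T k"
  have diff: "(\<alpha> - \<beta>) * T = pi * of_int (int j - int k)"
    and add: "(\<alpha> + \<beta>) * T = pi * of_int (int j + int k - 1)"
    using \<open>T > 0\<close> by (simp_all add: \<alpha>_def \<beta>_def kl_frequency_def field_simps)
  have sin_zero: "sin ((\<alpha> - \<beta>) * T) = 0" "sin ((\<alpha> + \<beta>) * T) = 0"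
    unfolding diff add by (rule sin_npi_int)+
  have nonzero: "\<alpha> - \<beta> \<noteq> 0" "\<alpha> + \<beta> \<noteq> 0"
  proof -
    have "(\<alpha> - \<beta>) * T \<noteq> 0" "(\<alpha> + \<beta>) * T \<noteq> 0"
      unfolding diff add mult_eq_0_iff of_int_eq_0_iff using assms by auto
    then show "\<alpha> - \<beta> \<noteq> 0" "\<alpha> + \<beta> \<noteq> 0" by auto
  qed
  define F where "F = (\<lambda>t. sin ((\<alpha> - \<beta>) * t) / (2 * (\<alpha> - \<beta>)) + sin ((\<alpha> + \<beta>) * t) / (2 * (\<alpha> + \<beta>)))"
  have sin_primitive: "((\<lambda>t. sin (c * t) / (2 * c)) has_real_derivative cos (c * t) / 2) (at t within S)"
    if "c \<noteq> 0" for c t S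
    using that by (auto intro!: derivative_eq_intros)
  have "(F has_vector_derivative cos (\<alpha> * t) * cos (\<beta> * t)) (at t within {0..T})" for t
  proof -
    have "(F has_real_derivative cos ((\<alpha> - \<beta>) * t) / 2 + cos ((\<alpha> + \<beta>) * t) / 2) (at t within {0..T})"
      unfolding F_def using nonzero by (intro DERIV_add sin_primitive)
    also have "cos ((\<alpha> - \<beta>) * t) / 2 + cos ((\<alpha> + \<beta>) * t) / 2 = cos (\<alpha> * t) * cos (\<beta> * t)"
      by (simp add: left_diff_distrib distrib_right cos_diff cos_add field_simps)
    finally show ?thesis
      by (simp add: has_real_derivative_iff_has_vector_derivative)
  qed
  then have "(LINT t:{0..T}|lborel. cos (\<alpha> * t) * cos (\<beta> * t)) = F T - F 0"
    unfolding set_lebesgue_integral_def using \<open>T > 0\<close>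
    by (intro integral_FTC_atLeastAtMost continuous_intros) auto
  also have "\<dots> = 0"
    using sin_zero by (simp add: F_def)
  finally have cos_zero: "(LINT t:{0..T}|lborel. cos (\<alpha> * t) * cos (\<beta> * t)) = 0" .
  define c where "c = sqrt (2 / T)"
  have "(LINT t:{0..T}|lborel. kl_tail_integral T j t * kl_tail_integral T k t) =
      (LINT t:{0..T}|lborel. (c / \<alpha> * (c / \<beta>)) * (cos (\<alpha> * t) * cos (\<beta> * t)))"
    by (simp add: kl_tail_integral_def \<alpha>_def \<beta>_def mult_ac flip: c_def)
  then show ?thesis
    unfolding set_integral_mult_right cos_zero by simp
qed

context levy_process
begin

lemma random_variable_kl_coefficient: "T > 0 \<Longrightarrow> random_variable borel (kl_coefficient T X k)"
  unfolding kl_coefficient_def[abs_def] mult.commute[of "X _ _"]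
  using random_variable_weighted_path_integral[OF _ continuous_kl_eigenfunction has_derivative_kl_tail_integral] .

lemma char_kl_coefficients:
  assumes triplet: "has_levy_triplet M X h a \<sigma> \<nu>" and "T > 0"
  shows "(CLINT \<omega>|M. iexp (\<Sum>k\<in>I. u k * kl_coefficient T X k \<omega>)) =
         exp (- (CLINT t:{0..T}|lborel. levy_exponent h a \<sigma> \<nu> (\<Sum>k\<in>I. u k * kl_tail_integral T k t)))"
proof -
  have "(\<Sum>k\<in>I. u k * kl_coefficient T X k \<omega>) =
      (LINT t:{0..T}|lborel. (\<Sum>k\<in>I. u k * kl_eigenfunction T k t) * X t \<omega>)" if "\<omega> \<in> space M" for \<omega>
  proof -
    have "(\<Sum>k\<in>I. u k * kl_coefficient T X k \<omega>) =
        (\<Sum>k\<in>I. u k * (LINT t:{0..T}|lborel. kl_eigenfunction T k t * X t \<omega>))"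
      by (simp add: kl_coefficient_def mult.commute[of "X _ _"])
    also have "\<dots> = (LINT t:{0..T}|lborel. (\<Sum>k\<in>I. u k * (kl_eigenfunction T k t * X t \<omega>)))"
      by (intro set_integral_linear_combination[symmetric] weighted_path_integral(1)[OF \<open>T > 0\<close>
          continuous_kl_eigenfunction has_derivative_kl_tail_integral[OF \<open>T > 0\<close>] that])
    finally show ?thesis
      by (simp add: sum_distrib_right mult.assoc)
  qed
  then have "(CLINT \<omega>|M. iexp (\<Sum>k\<in>I. u k * kl_coefficient T X k \<omega>)) =
      (CLINT \<omega>|M. iexp (LINT t:{0..T}|lborel. (\<Sum>k\<in>I. u k * kl_eigenfunction T k t) * X t \<omega>))"
    by (intro Bochner_Integration.integral_cong) auto
  also have "\<dots> = exp (- (CLINT t:{0..T}|lborel. levy_exponent h a \<sigma> \<nu> (\<Sum>k\<in>I. u k * kl_tail_integral T k t)))"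
  proof (rule char_weighted_path_integral[OF triplet \<open>T > 0\<close>])
    show "continuous_on UNIV (\<lambda>t. \<Sum>k\<in>I. u k * kl_eigenfunction T k t)"
      by (intro continuous_intros continuous_kl_eigenfunction)
    show "((\<lambda>t. \<Sum>k\<in>I. u k * kl_tail_integral T k t) has_real_derivative - (\<Sum>k\<in>I. u k * kl_eigenfunction T k t)) (at t)" for t
      unfolding sum_negf[symmetric] mult_minus_right[symmetric]
      by (intro DERIV_sum DERIV_cmult has_derivative_kl_tail_integral \<open>T > 0\<close>)
  qed (simp add: kl_tail_integral_endpoint \<open>T > 0\<close>)
  finally show ?thesis .
qed

lemma set_integrable_levy_exponent_kl:
  assumes "has_levy_triplet M X h a \<sigma> \<nu>"
  shows "set_integrable lborel {0..T} (\<lambda>t. levy_exponent h a \<sigma> \<nu> (\<Sum>k\<in>I. u k * kl_tail_integral T k t))"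
proof (rule borel_integrable_atLeastAtMost')
  have "continuous_on UNIV (levy_exponent h a \<sigma> \<nu>)"
    using assms by (intro continuous_levy_exponent) (auto simp: has_levy_triplet_def)
  then show "continuous_on {0..T} (\<lambda>t. levy_exponent h a \<sigma> \<nu> (\<Sum>k\<in>I. u k * kl_tail_integral T k t))"
    by (rule continuous_on_compose2) (auto intro!: continuous_intros continuous_kl_tail_integral)
qed

text \<open>
  Without jumps, \<open>\<psi>(x + y) = \<psi>(x) + \<psi>(y) + \<sigma>\<^sup>2 x y\<close>, and orthogonality annihilates the
  integrated cross terms.
\<close>

lemma independent_kl_coefficients_if_gaussian:
  assumes triplet: "has_levy_triplet M X h a \<sigma> (null_measure borel)" and "T > 0"
  shows "independent_kl_coefficients M X T d"
  unfolding independent_kl_coefficients_def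
proof (rule indep_vars_if_char_factors)
  fix u :: "nat \<Rightarrow> real"
  define \<psi> where "\<psi> = levy_exponent h a \<sigma> (null_measure borel)"
  have \<psi>_add: "\<psi> (x + y) = \<psi> x + \<psi> y + of_real (\<sigma>\<^sup>2) * of_real (x * y)" and \<psi>_0: "\<psi> 0 = 0" for x y
    by (simp_all add: \<psi>_def levy_exponent_def power2_eq_square algebra_simps add_divide_distrib)
  have additive: "(CLINT t:{0..T}|lborel. \<psi> (\<Sum>k\<in>I. u k * kl_tail_integral T k t)) =
      (\<Sum>k\<in>I. CLINT t:{0..T}|lborel. \<psi> (u k * kl_tail_integral T k t))"
    if "finite I" "I \<subseteq> {1..d}" for I
    using that
  proof (induction I rule: finite_induct)
    case empty
    then show ?case by (simp add: \<psi>_0)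
  next
    case (insert j I)
    define G where "G = (\<lambda>t. \<Sum>k\<in>I. u k * kl_tail_integral T k t)"
    have int: "set_integrable lborel {0..T} (\<lambda>t. \<psi> (u j * kl_tail_integral T j t))"
      "set_integrable lborel {0..T} (\<lambda>t. \<psi> (G t))"
      using set_integrable_levy_exponent_kl[OF triplet, of T u "{j}"]
        set_integrable_levy_exponent_kl[OF triplet, of T u I] by (auto simp: \<psi>_def G_def)
    have int_cross: "set_integrable lborel {0..T} (\<lambda>t. of_real (\<sigma>\<^sup>2) * complex_of_real (u j * kl_tail_integral T j t * G t))"
      unfolding G_def by (intro borel_integrable_atLeastAtMost' continuous_intros continuous_kl_tail_integral)
    have "(LINT t:{0..T}|lborel. u j * kl_tail_integral T j t * G t) =
        (LINT t:{0..T}|lborel. (\<Sum>k\<in>I. u j * u k * (kl_tail_integral T j t * kl_tail_integral T k t)))"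
      unfolding G_def by (simp add: sum_distrib_left mult_ac)
    also have "\<dots> = (\<Sum>k\<in>I. u j * u k * (LINT t:{0..T}|lborel. kl_tail_integral T j t * kl_tail_integral T k t))"
      by (intro set_integral_linear_combination borel_integrable_atLeastAtMost' continuous_intros
          continuous_kl_tail_integral)
    also have "\<dots> = 0"
    proof (intro sum.neutral ballI)
      fix k assume "k \<in> I"
      with insert have "j \<ge> 1" "k \<ge> 1" "j \<noteq> k"
        by auto
      then show "u j * u k * (LINT t:{0..T}|lborel. kl_tail_integral T j t * kl_tail_integral T k t) = 0"
        using \<open>T > 0\<close> by (simp add: kl_tail_integrals_orthogonal)
    qed
    finally have cross: "(LINT t:{0..T}|lborel. u j * kl_tail_integral T j t * G t) = 0" .
    have "(CLINT t:{0..T}|lborel. \<psi> (\<Sum>k\<in>insert j I. u k * kl_tail_integral T k t)) =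
        (CLINT t:{0..T}|lborel. \<psi> (u j * kl_tail_integral T j t) + \<psi> (G t)
          + of_real (\<sigma>\<^sup>2) * of_real (u j * kl_tail_integral T j t * G t))"
      unfolding G_def sum.insert[OF insert.hyps] \<psi>_add ..
    also have "\<dots> = (CLINT t:{0..T}|lborel. \<psi> (u j * kl_tail_integral T j t)) + (CLINT t:{0..T}|lborel. \<psi> (G t))
        + of_real (\<sigma>\<^sup>2) * of_real (LINT t:{0..T}|lborel. u j * kl_tail_integral T j t * G t)"
      by (simp only: set_integral_add int int_cross set_integral_mult_right set_integral_complex_of_real)
    finally show ?case
      using insert unfolding cross by (simp add: G_def)
  qed
  have single: "(CLINT \<omega>|M. iexp (u k * kl_coefficient T X k \<omega>)) =
      exp (- (CLINT t:{0..T}|lborel. \<psi> (u k * kl_tail_integral T k t)))" for k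
    using char_kl_coefficients[OF triplet \<open>T > 0\<close>, where I = "{k}"] by (simp add: \<psi>_def)
  show "(CLINT \<omega>|M. iexp (\<Sum>k\<in>{1..d}. u k * kl_coefficient T X k \<omega>)) =
      (\<Prod>k\<in>{1..d}. CLINT \<omega>|M. iexp (u k * kl_coefficient T X k \<omega>))"
    unfolding char_kl_coefficients[OF triplet \<open>T > 0\<close>] single
    unfolding \<psi>_def[symmetric] additive[OF finite_atLeastAtMost order_refl]
    by (simp add: exp_sum flip: sum_negf)
qed (use \<open>T > 0\<close> in \<open>auto intro: random_variable_kl_coefficient\<close>)

text \<open>
  Independence of the two coefficients makes the integral of the parallelogram defect along
  \<open>(E\<^sub>j(t), E\<^sub>k(t))\<close> vanish, hence the defect itself at every \<open>t\<close>.
  The points \<open>T - s\<^sub>n\<close> with \<open>s\<^sub>n\<close> decreasing to \<open>0\<close> then rule out every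
  jump size \<open>x \<noteq> 0\<close> outside one \<open>\<nu>\<close>-null set.
\<close>

lemma levy_measure_null_if_kl_pair_independent:
  assumes triplet: "has_levy_triplet M X h a \<sigma> \<nu>" and "T > 0"
    and indep: "indep_vars (\<lambda>_. borel) (kl_coefficient T X) {j, k}" and "j \<noteq> k"
  shows "\<nu> = null_measure borel"
proof -
  have cutoff: "cutoff_function \<nu> h" and levy: "levy_measure \<nu>"
    using triplet by (auto simp: has_levy_triplet_def)
  define E where "E = kl_tail_integral T"
  define \<rho> where "\<rho> = (\<lambda>z. Re (levy_exponent h a \<sigma> \<nu> z))"
  have \<rho>_even: "\<rho> (- z) = \<rho> z" for z
    unfolding \<rho>_def Re_levy_exponent(2)[OF cutoff] by simp
  have \<rho>_cont: "continuous_on UNIV \<rho>"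
    unfolding \<rho>_def using continuous_levy_exponent[OF levy cutoff] by (intro continuous_intros)
  have \<rho>_E_cont: "continuous_on {0..T} (\<lambda>t. \<rho> (u * E j t + v * E k t))" for u v
    by (rule continuous_on_compose2[OF \<rho>_cont])
      (auto simp: E_def intro!: continuous_intros continuous_kl_tail_integral)
  define R where "R = (\<lambda>u v. LINT t:{0..T}|lborel. \<rho> (u * E j t + v * E k t))"
  have norm_char: "norm (CLINT \<omega>|M. iexp (u * kl_coefficient T X j \<omega> + v * kl_coefficient T X k \<omega>)) = exp (- R u v)" for u v
  proof -
    define w where "w = (\<lambda>i. if i = j then u else v)"
    have w: "(\<Sum>i\<in>{j, k}. w i * f i) = u * f j + v * f k" for f
      using \<open>j \<noteq> k\<close> by (simp add: w_def)
    have int: "integrable lborel (\<lambda>t. indicator {0..T} t *\<^sub>R levy_exponent h a \<sigma> \<nu> (u * E j t + v * E k t))"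
      using set_integrable_levy_exponent_kl[OF triplet, of T w "{j, k}"] unfolding w set_integrable_def E_def .
    have "Re (CLINT t:{0..T}|lborel. levy_exponent h a \<sigma> \<nu> (u * E j t + v * E k t)) = R u v"
      unfolding R_def \<rho>_def set_lebesgue_integral_def integral_Re[OF int, symmetric] by simp
    then show ?thesis
      using char_kl_coefficients[OF triplet \<open>T > 0\<close>, of w "{j, k}"] unfolding w E_def by simp
  qed
  have "R u v = R u 0 + R 0 v" for u v
  proof -
    define F where "F = (\<lambda>i \<omega>. iexp ((if i = j then u else v) * kl_coefficient T X i \<omega>))"
    have [measurable]: "kl_coefficient T X i \<in> borel_measurable M" for i
      using \<open>T > 0\<close> by (rule random_variable_kl_coefficient)
    have "indep_vars (\<lambda>_. borel) F {j, k}"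
      unfolding F_def by (rule indep_vars_compose2[OF indep]) measurable
    then have "(CLINT \<omega>|M. \<Prod>i\<in>{j, k}. F i \<omega>) = (\<Prod>i\<in>{j, k}. CLINT \<omega>|M. F i \<omega>)"
      by (intro indep_vars_lebesgue_integral) (auto intro!: integrable_const_bound[where B=1] simp: F_def)
    then have "(CLINT \<omega>|M. iexp (u * kl_coefficient T X j \<omega> + v * kl_coefficient T X k \<omega>)) =
        (CLINT \<omega>|M. iexp (u * kl_coefficient T X j \<omega> + 0 * kl_coefficient T X k \<omega>)) *
        (CLINT \<omega>|M. iexp (0 * kl_coefficient T X j \<omega> + v * kl_coefficient T X k \<omega>))"
      using \<open>j \<noteq> k\<close> by (simp add: F_def distrib_left exp_add)
    then have "exp (- R u v) = exp (- R u 0) * exp (- R 0 v)"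
      unfolding norm_char[symmetric] norm_mult[symmetric] by simp
    then show ?thesis
      by (simp flip: exp_add)
  qed
  \<comment> \<open>As \<open>\<rho>\<close> is even, \<open>R 0 (-1) = R 0 1\<close>.\<close>
  from this[of 1 1] this[of 1 "-1"] have "R 1 1 + R 1 (-1) = 2 * R 1 0 + 2 * R 0 1"
    by (simp add: R_def \<rho>_even)
  moreover define D where "D = (\<lambda>t. 2 * \<rho> (E j t) + 2 * \<rho> (E k t) - \<rho> (E j t + E k t) - \<rho> (E j t - E k t))"
  moreover have "(LINT t:{0..T}|lborel. D t) = 2 * R 1 0 + 2 * R 0 1 - R 1 1 - R 1 (-1)"
  proof -
    have int: "set_integrable lborel {0..T} (\<lambda>t. \<rho> (u * E j t + v * E k t))" for u v
      using \<rho>_E_cont by (rule borel_integrable_atLeastAtMost')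
    have "set_integrable lborel {0..T} (\<lambda>t. \<rho> (E j t))" "set_integrable lborel {0..T} (\<lambda>t. \<rho> (E k t))"
      "set_integrable lborel {0..T} (\<lambda>t. \<rho> (E j t + E k t))" "set_integrable lborel {0..T} (\<lambda>t. \<rho> (E j t - E k t))"
      using int[of 1 0] int[of 0 1] int[of 1 1] int[of 1 "-1"] by simp_all
    then show ?thesis
      unfolding D_def R_def by simp
  qed
  ultimately have D_integral: "(LINT t:{0..T}|lborel. D t) = 0"
    by simp
  note defect_integrable = parallelogram_defect(1)[OF cutoff]
  have defect: "2 * \<rho> y + 2 * \<rho> z - \<rho> (y + z) - \<rho> (y - z) =
      (LINT x|\<nu>. 2 * (1 - cos (y * x)) * (1 - cos (z * x)))" for y z
    unfolding \<rho>_def by (rule parallelogram_defect(2)[OF cutoff])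
  have defect_nonneg: "2 * (1 - cos y) * (1 - cos z) \<ge> 0" for y z :: real
    by (intro mult_nonneg_nonneg) auto
  have D_cont: "continuous_on {0..T} D"
    using \<rho>_E_cont[of 1 0] \<rho>_E_cont[of 0 1] \<rho>_E_cont[of 1 1] \<rho>_E_cont[of 1 "-1"]
    unfolding D_def by (auto intro!: continuous_intros)
  have "D t \<ge> 0" for t
    unfolding D_def defect by (intro integral_nonneg_AE AE_I2 defect_nonneg)
  then have D_zero: "D t = 0" if "t \<in> {0..T}" for t
    using integral_eq_0_iff[OF D_cont \<open>T > 0\<close>] that D_integral
      set_borel_integral_eq_integral(2)[OF borel_integrable_atLeastAtMost'[OF D_cont]] by auto
  define s where "s = (\<lambda>n. T / real (Suc n))"
  have "AE x in \<nu>. 2 * (1 - cos (E j (T - s n) * x)) * (1 - cos (E k (T - s n) * x)) = 0" for n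
  proof -
    have "T - s n \<in> {0..T}"
      using \<open>T > 0\<close> by (auto simp: s_def field_simps)
    from D_zero[OF this] show ?thesis
      unfolding D_def defect using integral_nonneg_eq_0_iff_AE[OF defect_integrable] defect_nonneg by auto
  qed
  then have "AE x in \<nu>. \<forall>n. 2 * (1 - cos (E j (T - s n) * x)) * (1 - cos (E k (T - s n) * x)) = 0"
    by (simp only: AE_all_countable) simp
  moreover have "AE x in \<nu>. x \<noteq> 0"
    using levy by (intro AE_I[of _ _ "{0}"]) (auto simp: levy_measure_def)
  ultimately have "AE x in \<nu>. False"
  proof eventually_elim
    case (elim x)
    have s_pos: "s n > 0" for n
      using \<open>T > 0\<close> by (simp add: s_def)
    have s_lim: "s \<longlonglongrightarrow> 0"
      unfolding s_def by (rule LIMSEQ_Suc[OF lim_const_over_n])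
    have cos_neq_1: "eventually (\<lambda>n. cos (E i (T - s n) * x) \<noteq> 1) sequentially" for i
    proof -
      have "(\<lambda>n. \<bar>kl_frequency T i * s n\<bar>) \<longlonglongrightarrow> \<bar>kl_frequency T i * 0\<bar>"
        by (intro tendsto_intros s_lim)
      then have "eventually (\<lambda>n. \<bar>kl_frequency T i * s n\<bar> < pi) sequentially"
        by (rule order_tendstoD) simp
      moreover have "(\<lambda>n. \<bar>E i (T - s n) * x / 2\<bar>) \<longlonglongrightarrow> \<bar>E i (T - 0) * x / 2\<bar>"
        unfolding E_def
        by (intro tendsto_intros continuous_on_tendsto_compose[OF continuous_kl_tail_integral[of UNIV]] s_lim) auto
      then have "eventually (\<lambda>n. \<bar>E i (T - s n) * x / 2\<bar> < pi) sequentially"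
        by (rule order_tendstoD) (simp add: E_def kl_tail_integral_endpoint \<open>T > 0\<close>)
      ultimately show ?thesis
      proof eventually_elim
        case (elim n)
        have "E i (T - s n) \<noteq> 0"
          unfolding E_def using elim(1) \<open>T > 0\<close> s_pos[of n] kl_frequency_nonzero[of T i]
          by (intro kl_tail_integral_near_endpoint) auto
        \<comment> \<open>Half angles, since \<open>1 - cos y = 2 (sin (y/2))\<^sup>2\<close>.\<close>
        then have "sin (E i (T - s n) * x / 2) \<noteq> 0"
          using sin_zero_pi_iff[OF elim(2)] \<open>x \<noteq> 0\<close> by simp
        then show ?case
          using cos_double_sin[of "E i (T - s n) * x / 2"] by simp
      qed
    qed
    from eventually_conj[OF cos_neq_1[of j] cos_neq_1[of k]]
    obtain n where "cos (E j (T - s n) * x) \<noteq> 1" "cos (E k (T - s n) * x) \<noteq> 1"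
      by (auto simp: eventually_sequentially)
    then show False
      using elim(1)[rule_format, of n] by simp
  qed
  then have "emeasure \<nu> (space \<nu>) = 0"
    using trivial_limit_def ae_filter_eq_bot_iff by blast
  then have "emeasure \<nu> A = 0" if "A \<in> sets \<nu>" for A
    using emeasure_space[of \<nu> A] by simp
  then show ?thesis
    using levy by (intro measure_eqI) (auto simp: levy_measure_def)
qed

end

theorem corollary2:
  fixes M :: "'a measure" and X :: "real \<Rightarrow> 'a \<Rightarrow> real"
    and h :: "real \<Rightarrow> real" and a \<sigma> T :: real and \<nu> :: "real measure" and d :: nat
  assumes "centered_L2_levy_process M X"
    and "has_levy_triplet M X h a \<sigma> \<nu>"
    and "T > 0" and "d \<ge> 1"
  shows "(d \<ge> 2 \<longrightarrow> (independent_kl_coefficients M X T d \<longleftrightarrow> \<nu> = null_measure borel)) \<and>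
         (\<nu> = null_measure borel \<longrightarrow> independent_kl_coefficients M X T d)"
proof -
  interpret centered_L2_levy_process M X by fact
  have null_imp_indep: "independent_kl_coefficients M X T d" if "\<nu> = null_measure borel"
    using assms(2,3) unfolding that by (rule independent_kl_coefficients_if_gaussian)
  moreover have "\<nu> = null_measure borel" if "independent_kl_coefficients M X T d" "d \<ge> 2"
  proof (rule levy_measure_null_if_kl_pair_independent[OF assms(2,3)])
    show "indep_vars (\<lambda>_. borel) (kl_coefficient T X) {1, 2}"
      using that by (auto simp: independent_kl_coefficients_def intro: indep_vars_subset)
  qed simp
  ultimately show ?thesis
    by blast
qed

end
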